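(* Let $\mathcal{H}$ be a finite-dimensional Hilbert space, let $G_1,\ldots,G_J$ be Hermitian operators on $\mathcal{H}$, and for $\theta\in\mathbb{R}^J$ let $G(\theta)=\sum_{j=1}^J\theta_j G_j$ and $\rho(\theta)=e^{-G(\theta)}/\operatorname{Tr}[e^{-G(\theta)}]$. Then for all $i,j\in\{1,\ldots,J\}$ the Kubo--Mori information matrix of the family $(\rho(\theta))_{\theta\in\mathbb{R}^J}$ satisfies $$I^{\mathrm{KM}}_{ij}(\theta)=\tfrac12\operatorname{Tr}\big[\{G_i,\Phi_\theta(G_j)\}\rho(\theta)\big]-\operatorname{Tr}[G_i\rho(\theta)]\operatorname{Tr}[G_j\rho(\theta)],$$ where $\{A,B\}=AB+BA$.
   Context: The "high-peak tent" probability density on $\mathbb{R}$ is $p(t)=\frac{2}{\pi}\ln|\coth(\pi t/2)|$. The quantum channel $\Phi_\theta$ is defined on operators $X$ on $\mathcal{H}$ by $\Phi_\theta(X)=\int_{\mathbb{R}}dt\,p(t)\,e^{-iG(\theta)t}Xe^{iG(\theta)t}$. For a differentiable family $(\sigma(\theta))_{\theta\in\mathbb{R}^J}$ of positive-definite density operators with spectral decomposition $\sigma(\theta)=\sum_k\lambda_k|k\rangle\langle k|$, the Kubo--Mori information matrix is $I^{\mathrm{KM}}_{ij}(\theta)=\sum_{k,\ell}c_{\mathrm{KM}}(\lambda_k,\lambda_\ell)\langle k|\partial_i\sigma(\theta)|\ell\rangle\langle\ell|\partial_j\sigma(\theta)|k\rangle$, where $\partial_i=\partial/\partial\theta_i$,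 $c_{\mathrm{KM}}(x,x)=1/x$ and $c_{\mathrm{KM}}(x,y)=\frac{\ln x-\ln y}{x-y}$ for $x\neq y$. *)

theory Defs
  imports "HOL-Analysis.Analysis" "Jordan_Normal_Form.Matrix"
begin

text \<open>Operators on the n-dimensional Hilbert space are represented as n x n complex matrices
  (w.r.t. a fixed orthonormal basis).\<close>

definition adj :: "complex mat \<Rightarrow> complex mat" where
  "adj A = mat (dim_col A) (dim_row A) (\<lambda>(i,j). cnj (A $$ (j,i)))"

definition hermitian :: "nat \<Rightarrow> complex mat \<Rightarrow> bool" where
  "hermitian n A \<longleftrightarrow> A \<in> carrier_mat n n \<and> adj A = A"

definition unitary :: "nat \<Rightarrow> complex mat \<Rightarrow> bool" where
  "unitary n U \<longleftrightarrow> U \<in> carrier_mat n n \<and> adj U * U = 1\<^sub>m n \<and> U * adj U = 1\<^sub>m n"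

definition mexp :: "complex mat \<Rightarrow> complex mat" where
  "mexp A = mat (dim_row A) (dim_col A)
     (\<lambda>(a,b). \<Sum>k. (A ^\<^sub>m k) $$ (a,b) / of_nat (fact k))"

definition mtrace :: "complex mat \<Rightarrow> complex" where
  "mtrace A = (\<Sum>k<dim_row A. A $$ (k,k))"

definition anticomm :: "complex mat \<Rightarrow> complex mat \<Rightarrow> complex mat" where
  "anticomm A B = A * B + B * A"

definition coth :: "real \<Rightarrow> real" where
  "coth x = cosh x / sinh x"

definition tent :: "real \<Rightarrow> real" where
  "tent t = 2 / pi * ln \<bar>coth (pi * t / 2)\<bar>"

definition Gth :: "nat \<Rightarrow> nat \<Rightarrow> (nat \<Rightarrow> complex mat) \<Rightarrow> (nat \<Rightarrow> real) \<Rightarrow> complex mat" where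
  "Gth n J G \<theta> = mat n n (\<lambda>(a,b). \<Sum>j<J. complex_of_real (\<theta> j) * G j $$ (a,b))"

definition rho :: "nat \<Rightarrow> nat \<Rightarrow> (nat \<Rightarrow> complex mat) \<Rightarrow> (nat \<Rightarrow> real) \<Rightarrow> complex mat" where
  "rho n J G \<theta> = (1 / mtrace (mexp (- Gth n J G \<theta>))) \<cdot>\<^sub>m mexp (- Gth n J G \<theta>)"

definition Phi :: "nat \<Rightarrow> nat \<Rightarrow> (nat \<Rightarrow> complex mat) \<Rightarrow> (nat \<Rightarrow> real) \<Rightarrow> complex mat \<Rightarrow> complex mat" where
  "Phi n J G \<theta> X = mat n n (\<lambda>(a,b). integral\<^sup>L lborel (\<lambda>t.
      complex_of_real (tent t) *
      (mexp ((- \<i> * complex_of_real t) \<cdot>\<^sub>m Gth n J G \<theta>) * X *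
       mexp ((\<i> * complex_of_real t) \<cdot>\<^sub>m Gth n J G \<theta>)) $$ (a,b)))"

definition mat_partial :: "nat \<Rightarrow> ((nat \<Rightarrow> real) \<Rightarrow> complex mat) \<Rightarrow> nat \<Rightarrow> (nat \<Rightarrow> real) \<Rightarrow> complex mat" where
  "mat_partial n F i \<theta> = mat n n (\<lambda>(a,b).
      vector_derivative (\<lambda>s::real. F (\<theta>(i := s)) $$ (a,b)) (at (\<theta> i)))"

definition c_KM :: "real \<Rightarrow> real \<Rightarrow> real" where
  "c_KM x y = (if x = y then 1 / x else (ln x - ln y) / (x - y))"

text \<open>Kubo--Mori information matrix entry, computed from a spectral decomposition
  sigma(theta) = sum_k lam_k |k><k|, where |k> is the k-th column of the unitary U.\<close>
definition KM_info :: "nat \<Rightarrow> ((nat \<Rightarrow> real) \<Rightarrow> complex mat) \<Rightarrow> (nat \<Rightarrow> real) \<Rightarrow>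
     complex mat \<Rightarrow> (nat \<Rightarrow> real) \<Rightarrow> nat \<Rightarrow> nat \<Rightarrow> complex" where
  "KM_info n \<sigma> \<theta> U lam i j =
     (\<Sum>k<n. \<Sum>l<n. complex_of_real (c_KM (lam k) (lam l)) *
        (adj U * mat_partial n \<sigma> i \<theta> * U) $$ (k,l) *
        (adj U * mat_partial n \<sigma> j \<theta> * U) $$ (l,k))"

end

theory Submission
  imports Defs
    "Jordan_Normal_Form.Jordan_Normal_Form_Existence"
    "Jordan_Normal_Form.Jordan_Normal_Form_Uniqueness"
begin

text \<open>Write everything in an eigenbasis of the Gibbs state, with eigenvalues \<open>\<lambda>\<^sub>k\<close>; it is also an
  eigenbasis of \<open>G(\<theta>)\<close>, with eigenvalues \<open>- ln (Z \<lambda>\<^sub>k)\<close>. Differentiating the exponential series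
  termwise shows that \<open>\<partial>\<^sub>i e\<^sup>-\<^sup>G\<close> has entries \<open>- (G\<^sub>i)\<^sub>k\<^sub>l Z / c\<^sub>K\<^sub>M(\<lambda>\<^sub>k, \<lambda>\<^sub>l)\<close>, so that the Kubo--Mori matrix is
  \<open>\<Sum>\<^sub>k\<^sub>l (G\<^sub>i)\<^sub>k\<^sub>l (G\<^sub>j)\<^sub>l\<^sub>k / c\<^sub>K\<^sub>M(\<lambda>\<^sub>k, \<lambda>\<^sub>l)\<close> minus the product of the means. The channel multiplies the
  \<open>(l,k)\<close> entry by the Fourier transform of the tent density at \<open>\<omega> = ln \<lambda>\<^sub>k - ln \<lambda>\<^sub>l\<close>. This transform is
  \<open>tanh(\<omega>/2) / (\<omega>/2)\<close>: expand \<open>ln coth\<close> into exponentials and recognise the partial fractions of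
  \<open>tanh\<close>, which come from the logarithmic derivative of Euler's reflection formula. Finally
  \<open>tanh(\<omega>/2) = (\<lambda>\<^sub>k - \<lambda>\<^sub>l) / (\<lambda>\<^sub>k + \<lambda>\<^sub>l)\<close> turns \<open>(\<lambda>\<^sub>k + \<lambda>\<^sub>l) / 2\<close> times the transform into \<open>1 / c\<^sub>K\<^sub>M(\<lambda>\<^sub>k, \<lambda>\<^sub>l)\<close>.\<close>

section \<open>The Fourier transform of the tent density\<close>

text \<open>Differentiate the reflection formula
  \<open>rGamma (1/2 + w) * rGamma (1/2 - w) = cos (pi w) / pi\<close> in two ways. The reciprocal
  Gamma function is entire, so the identity itself holds at every point, and leaving the cosine as a
  factor avoids a division.\<close>

lemma sin_deriv_reflection:
  fixes w :: complex
  assumes "1/2 + w \<notin> \<int>\<^sub>\<le>\<^sub>0" "1/2 - w \<notin> \<int>\<^sub>\<le>\<^sub>0"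
  shows "cos (of_real pi * w) * (Digamma (1/2 + w) - Digamma (1/2 - w)) = of_real pi * sin (of_real pi * w)"
proof -
  let ?f = "\<lambda>w::complex. rGamma (1/2 + w) * rGamma (1/2 - w)"
  have f_eq: "?f z = cos (of_real pi * z) / of_real pi" for z
  proof -
    have "?f z = rGamma (1/2 + z) * rGamma (1 - (1/2 + z))" by (simp add: algebra_simps)
    also have "\<dots> = sin (of_real pi * (1/2 + z)) / of_real pi" by (rule rGamma_reflection_complex)
    also have "of_real pi * (1/2 + z) = of_real pi * z + of_real pi / 2" by (simp add: algebra_simps)
    also have "sin (of_real pi * z + of_real pi / 2) = cos (of_real pi * z)"
      by (simp add: sin_add flip: of_real_divide sin_of_real cos_of_real)
    finally show ?thesis .
  qed
  have "(?f has_field_derivative ?f w * (Digamma (1/2 - w) - Digamma (1/2 + w))) (at w)"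
    using assms by (auto intro!: derivative_eq_intros simp: algebra_simps)
  moreover have "(?f has_field_derivative - sin (of_real pi * w)) (at w)"
    unfolding f_eq by (auto intro!: derivative_eq_intros)
  ultimately have "?f w * (Digamma (1/2 - w) - Digamma (1/2 + w)) = - sin (of_real pi * w)"
    by (rule DERIV_unique)
  then show ?thesis unfolding f_eq by (simp add: field_simps)
qed

text \<open>On the imaginary axis the reflection identity turns into one between \<open>cosh\<close>
  and \<open>sinh\<close>; \<open>cosh\<close> has no real zero, so it can be cancelled, and the
  series of \<open>Digamma\<close> supplies the terms.\<close>

lemma tanh_partial_fractions:
  fixes y :: real
  shows "(\<lambda>k. 2 * y / ((real k + 1/2)^2 + y^2)) sums (pi * tanh (pi * y))"
proof -
  define w where "w = \<i> * complex_of_real y"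
  have ni: "1/2 + w \<notin> \<int>\<^sub>\<le>\<^sub>0" "1/2 - w \<notin> \<int>\<^sub>\<le>\<^sub>0"
    by (auto simp: w_def complex_eq_iff elim!: nonpos_Ints_cases)
  have nz: "1/2 + w \<noteq> 0" "1/2 - w \<noteq> 0"
    by (auto simp: w_def complex_eq_iff)
  have cosw: "cos (of_real pi * w) = of_real (cosh (pi * y))"
   and sinw: "sin (of_real pi * w) = \<i> * of_real (sinh (pi * y))"
  proof -
    have "of_real pi * w = \<i> * of_real (pi * y)" by (simp add: w_def)
    then show "cos (of_real pi * w) = of_real (cosh (pi * y))"
      "sin (of_real pi * w) = \<i> * of_real (sinh (pi * y))"
      by (simp_all only: cos_i_times sin_i_times) (simp_all add: cosh_def sinh_def scaleR_conv_of_real exp_minus flip: exp_of_real)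
  qed
  have D: "Digamma (1/2 + w) - Digamma (1/2 - w) = \<i> * of_real (pi * tanh (pi * y))"
  proof -
    have "of_real (cosh (pi * y)) * (Digamma (1/2 + w) - Digamma (1/2 - w))
        = of_real (cosh (pi * y)) * (\<i> * of_real (pi * tanh (pi * y)))"
      using sin_deriv_reflection[OF ni] cosh_real_pos[of "pi * y"]
      unfolding cosw sinw by (simp add: tanh_def)
    then show ?thesis using cosh_real_pos[of "pi * y"] by (simp del: of_real_mult)
  qed
  \<comment> \<open>In the difference of the two \<open>Digamma\<close> series the regularising
    terms \<open>1 / (k + 1)\<close> and Euler's constant cancel.\<close>
  have "(\<lambda>k. (inverse (of_nat (Suc k)) - inverse (1/2 + w + of_nat k))
          - (inverse (of_nat (Suc k)) - inverse (1/2 - w + of_nat k)))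
        sums ((Digamma (1/2 + w) + euler_mascheroni) - (Digamma (1/2 - w) + euler_mascheroni))"
    unfolding Digamma_def diff_add_cancel
    by (intro sums_diff summable_sums summable_Digamma nz)
  then have "(\<lambda>k. inverse (1/2 - w + of_nat k) - inverse (1/2 + w + of_nat k))
        sums (\<i> * of_real (pi * tanh (pi * y)))"
    using D by simp
  moreover have "inverse (1/2 - w + of_nat k) - inverse (1/2 + w + of_nat k)
      = \<i> * of_real (2 * y / ((real k + 1/2)^2 + y^2))" for k
  proof -
    have nz': "1/2 - w + of_nat k \<noteq> 0" "1/2 + w + of_nat k \<noteq> 0"
      by (auto simp: w_def complex_eq_iff)
    have "(real k + 1/2)^2 + y^2 > 0"
      by (intro add_pos_nonneg) auto
    then have nz2: "complex_of_real ((real k + 1/2)^2 + y^2) \<noteq> 0"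
      by (simp only: of_real_eq_0_iff)
    have "(1/2 - w + of_nat k) * (1/2 + w + of_nat k) = of_real ((real k + 1/2)^2 + y^2)"
      by (simp add: w_def power2_eq_square algebra_simps)
    moreover have "inverse (1/2 - w + of_nat k) - inverse (1/2 + w + of_nat k)
      = 2 * w / ((1/2 - w + of_nat k) * (1/2 + w + of_nat k))"
      using nz' by (simp add: inverse_eq_divide diff_frac_eq)
    ultimately show ?thesis by (simp add: w_def)
  qed
  ultimately have "(\<lambda>k. \<i> * complex_of_real (2 * y / ((real k + 1/2)^2 + y^2))) sums (\<i> * of_real (pi * tanh (pi * y)))"
    by simp
  then have "(\<lambda>k. complex_of_real (2 * y / ((real k + 1/2)^2 + y^2))) sums (of_real (pi * tanh (pi * y)))"
    by (subst (asm) sums_mult_iff) auto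
  then show ?thesis by (simp only: sums_of_real_iff)
qed

text \<open>The removable singularity at \<open>0\<close> is filled with the limit \<open>1\<close>,
  which is the total mass of the tent density.\<close>

definition tent_hat :: "real \<Rightarrow> real" where
  "tent_hat w = (if w = 0 then 1 else tanh (w / 2) / (w / 2))"

text \<open>Group the Basel series in pairs; the even squares contribute a quarter of the whole,
  leaving \<open>pi^2 / 6 - pi^2 / 24\<close>.\<close>

lemma odd_inverse_squares_sums: "(\<lambda>k. 1 / (2 * real k + 1)^2) sums (pi^2 / 8)"
proof -
  let ?f = "\<lambda>n. 1 / (real n + 1)^2"
  have f: "?f sums (pi^2 / 6)" using inverse_squares_sums by (simp add: add_ac)
  have "(\<lambda>n. sum ?f {n * 2..<n * 2 + 2}) sums (pi^2 / 6)"
    by (rule sums_group[OF f]) simp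
  moreover have "sum ?f {n * 2..<n * 2 + 2} = 1 / (2 * real n + 1)^2 + ?f n / 4" for n
  proof -
    have "{n * 2..<n * 2 + 2} = {2 * n, 2 * n + 1}" by auto
    moreover have "(real (2 * n + 1) + 1)^2 = 4 * (real n + 1)^2"
      by (simp add: power2_eq_square algebra_simps)
    ultimately show ?thesis by simp
  qed
  ultimately have "(\<lambda>n. 1 / (2 * real n + 1)^2 + ?f n / 4) sums (pi^2 / 6)" by simp
  from sums_diff[OF this sums_divide[OF f, of 4]] show ?thesis by (simp add: field_simps)
qed

lemma tent_hat_sums:
  "(\<lambda>k. 8 / (((2 * real k + 1) * pi)^2 + w^2)) sums tent_hat w"
proof (cases "w = 0")
  case True
  have "8 / pi^2 * (1 / (2 * real k + 1)^2) = 8 / (((2 * real k + 1) * pi)^2 + w^2)" for k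
    using True by (simp add: power_mult_distrib)
  moreover have "(\<lambda>k. 8 / pi^2 * (1 / (2 * real k + 1)^2)) sums (8 / pi^2 * (pi^2 / 8))"
    by (intro sums_mult odd_inverse_squares_sums)
  ultimately show ?thesis using True by (simp add: tent_hat_def)
next
  case False
  \<comment> \<open>Chosen so that \<open>pi * y = w / 2\<close>; the factor
    \<open>2 / (w * pi)\<close> below then normalises the \<open>tanh\<close> series. It degenerates
    at \<open>w = 0\<close>, hence the separate case above.\<close>
  define y where "y = w / (2 * pi)"
  have "2 / (w * pi) * (2 * y / ((real k + 1/2)^2 + y^2)) = 8 / (((2 * real k + 1) * pi)^2 + w^2)" for k
  proof -
    have *: "((2 * real k + 1) * pi)^2 + w^2 = 4 * pi^2 * ((real k + 1/2)^2 + y^2)"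
      unfolding y_def by (simp add: power2_eq_square field_simps)
    have "(real k + 1/2)^2 + y^2 > 0" by (intro add_pos_nonneg) auto
    then show ?thesis unfolding * using False
      by (simp add: y_def power2_eq_square divide_simps)
  qed
  moreover have "(\<lambda>k. 2 / (w * pi) * (2 * y / ((real k + 1/2)^2 + y^2))) sums
     (2 / (w * pi) * (pi * tanh (pi * y)))"
    by (intro sums_mult tanh_partial_fractions)
  moreover have "2 / (w * pi) * (pi * tanh (pi * y)) = tent_hat w"
    using False by (simp add: tent_hat_def y_def)
  ultimately show ?thesis by simp
qed

text \<open>With \<open>q = exp (- pi * \<bar>t\<bar>)\<close> the argument of the logarithm is
  \<open>(1 + q) / (1 - q)\<close>, whose logarithm is twice the sum of the odd powers
  \<open>q ^ (2 * k + 1) / (2 * k + 1)\<close>.\<close>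

lemma tent_sums:
  assumes "t \<noteq> 0"
  shows "(\<lambda>k. 4 / pi / (2 * real k + 1) * exp (- ((2 * real k + 1) * pi) * \<bar>t\<bar>)) sums tent t"
proof -
  define q where "q = exp (- pi * \<bar>t\<bar>)"
  have q: "0 < q" "q < 1" using assms by (auto simp: q_def)
  have c: "\<bar>coth (pi * t / 2)\<bar> = (1 + q) / (1 - q)"
  proof -
    have "\<bar>coth (pi * t / 2)\<bar> = cosh (pi * \<bar>t\<bar> / 2) / sinh (pi * \<bar>t\<bar> / 2)"
    proof (cases "t > 0")
      case True
      then show ?thesis by (simp add: coth_def)
    next
      case False
      then have "\<bar>t\<bar> = - t" "t < 0" using assms by auto
      moreover have "sinh (pi * t / 2) < 0" using \<open>t < 0\<close> by (simp add: mult_pos_neg)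
      ultimately show ?thesis by (simp add: coth_def abs_of_neg)
    qed
    also have "\<dots> = (exp (pi * \<bar>t\<bar> / 2) + exp (- (pi * \<bar>t\<bar> / 2))) / (exp (pi * \<bar>t\<bar> / 2) - exp (- (pi * \<bar>t\<bar> / 2)))"
      by (simp only: cosh_def sinh_def real_scaleR_def) (rule mult_divide_mult_cancel_left, simp)
    also have "\<dots> = (exp (pi * \<bar>t\<bar> / 2) * (1 + q)) / (exp (pi * \<bar>t\<bar> / 2) * (1 - q))"
      by (simp add: q_def ring_distribs flip: exp_add)
    finally show ?thesis by simp
  qed
  have pos: "(1 + q) / (1 - q) > 0" using q by simp
  \<comment> \<open>\<open>ln_series_quadratic\<close> expands \<open>ln x\<close> in powers of
    \<open>(x - 1) / (x + 1)\<close>, which is \<open>q\<close> here.\<close>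
  have y: "((1 + q) / (1 - q) - 1) / ((1 + q) / (1 - q) + 1) = q"
    using q by (simp add: field_simps)
  have "(\<lambda>n. 2 / pi * (2 * q ^ (2 * n + 1) / of_nat (2 * n + 1))) sums (2 / pi * ln ((1 + q) / (1 - q)))"
    using ln_series_quadratic[OF pos] unfolding y by (rule sums_mult)
  moreover have "2 / pi * (2 * q ^ (2 * k + 1) / of_nat (2 * k + 1))
     = 4 / pi / (2 * real k + 1) * exp (- ((2 * real k + 1) * pi) * \<bar>t\<bar>)" for k
  proof -
    have "q ^ (2 * k + 1) = exp (real (2 * k + 1) * (- pi * \<bar>t\<bar>))"
      unfolding q_def by (rule exp_of_nat_mult[symmetric])
    also have "real (2 * k + 1) * (- pi * \<bar>t\<bar>) = - ((2 * real k + 1) * pi) * \<bar>t\<bar>" by simp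
    finally show ?thesis by (simp add: divide_simps)
  qed
  ultimately show ?thesis by (simp add: tent_def c)
qed

section \<open>Fourier integrals of exponentials and termwise integration\<close>

text \<open>Integrability follows from the modulus \<open>exp (- Re z * t)\<close>, and the value
  from the antiderivative \<open>- exp (- z * t) / z\<close>.\<close>

lemma has_bochner_integral_exp_halfline:
  fixes z :: complex
  assumes "Re z > 0"
  shows "has_bochner_integral lborel (\<lambda>t. indicator {0<..} t *\<^sub>R exp (- z * of_real t)) (1 / z)"
proof -
  have z: "z \<noteq> 0" using assms by auto
  have e: "einterval 0 \<infinity> = {0<..}" by (auto simp: einterval_def)
  have "((\<lambda>t. exp (- Re z * t)) has_integral exp (- Re z * 0) / Re z) {0..}"
    by (rule has_integral_exp_minus_to_infinity) fact
  then have "(\<lambda>t. exp (- Re z * t)) absolutely_integrable_on {0..}"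
    by (intro nonnegative_absolutely_integrable_1) auto
  then have "(\<lambda>t. exp (- Re z * t)) absolutely_integrable_on {0<..}"
    by (rule set_integrable_subset) auto
  then have "integrable lborel (\<lambda>t. indicator {0<..} t *\<^sub>R exp (- Re z * t))"
    unfolding set_integrable_def by (subst (asm) integrable_completion) auto
  then have int: "integrable lborel (\<lambda>t. indicator {0<..} t *\<^sub>R exp (- z * of_real t))"
    by (rule Bochner_Integration.integrable_bound) (auto split: split_indicator)
  have "(LBINT t=0..\<infinity>. exp (- z * of_real t)) = 0 - (- exp (- z * of_real 0) / z)"
  proof (rule interval_integral_FTC_integrable[where F = "\<lambda>t. - exp (- z * of_real t) / z"])
    show "((\<lambda>t. - exp (- z * of_real t) / z) has_vector_derivative exp (- z * of_real x)) (at x)" for x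
      using z by (auto intro!: derivative_eq_intros has_vector_derivative_real_field)
    show "set_integrable lborel (einterval 0 \<infinity>) (\<lambda>t. exp (- z * of_real t))"
      using int by (simp add: e set_integrable_def)
    have "((\<lambda>t. - exp (- z * of_real t) / z) \<longlongrightarrow> - exp (- z * of_real 0) / z) (at_right (0::real))"
      using z by (intro tendsto_intros) auto
    then show "(((\<lambda>t. - exp (- z * of_real t) / z) \<circ> real_of_ereal) \<longlongrightarrow> - exp (- z * of_real 0) / z) (at_right 0)"
      by (simp add: zero_ereal_def ereal_tendsto_simps)
    have "((\<lambda>t. exp (- Re z * t)) \<longlongrightarrow> 0) at_top"
      using assms by real_asymp
    then have "((\<lambda>t. norm (exp (- z * of_real t))) \<longlongrightarrow> 0) at_top"
      by simp
    then have "((\<lambda>t. - exp (- z * of_real t) / z) \<longlongrightarrow> - 0 / z) at_top"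
      using z by (intro tendsto_intros) (auto intro: tendsto_norm_zero_cancel)
    then show "(((\<lambda>t. - exp (- z * of_real t) / z) \<circ> real_of_ereal) \<longlongrightarrow> 0) (at_left \<infinity>)"
      by (simp add: ereal_tendsto_simps)
  qed (auto intro!: continuous_intros)
  then have "integral\<^sup>L lborel (\<lambda>t. indicator {0<..} t *\<^sub>R exp (- z * of_real t)) = 1 / z"
    by (simp add: interval_lebesgue_integral_def e set_lebesgue_integral_def)
  with int show ?thesis by (simp add: has_bochner_integral_iff)
qed

text \<open>The negative half-line is the reflection of the positive one with \<open>w\<close>
  negated, so the value is \<open>1 / (a + \<i> w) + 1 / (a - \<i> w)\<close>. Both half-lines are
  open, which leaves the value \<open>0\<close> at the origin.\<close>

lemma has_bochner_integral_exp_abs: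
  fixes a w :: real
  assumes "a > 0"
  shows "has_bochner_integral lborel
    (\<lambda>t. (if t = 0 then 0 else exp (- of_real (a * \<bar>t\<bar>) - \<i> * of_real (w * t))))
    (complex_of_real (2 * a / (a^2 + w^2)))"
proof -
  let ?g = "\<lambda>w t. indicator {0<..} t *\<^sub>R exp (- (of_real a + \<i> * of_real w) * complex_of_real t)"
  have g: "has_bochner_integral lborel (?g w) (1 / (of_real a + \<i> * of_real w))" for w
    by (rule has_bochner_integral_exp_halfline) (simp add: assms)
  have "has_bochner_integral lborel (\<lambda>t. ?g (- w) (0 + (- 1) * t)) ((1 / (of_real a + \<i> * of_real (- w))) /\<^sub>R \<bar>- 1\<bar>)"
    using g[of "- w"] by (subst lborel_has_bochner_integral_real_affine_iff[symmetric]) auto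
  then have "has_bochner_integral lborel (\<lambda>t. ?g w t + ?g (- w) (- t))
      (1 / (of_real a + \<i> * of_real w) + 1 / (of_real a + \<i> * of_real (- w)))"
    using g[of w] by (intro has_bochner_integral_add) auto
  moreover have "?g w t + ?g (- w) (- t) = (if t = 0 then 0 else exp (- of_real (a * \<bar>t\<bar>) - \<i> * of_real (w * t)))" for t
    by (cases "t > 0"; cases "t = 0") (simp_all add: algebra_simps)
  moreover have "1 / (of_real a + \<i> * of_real w) + 1 / (of_real a + \<i> * of_real (- w)) = complex_of_real (2 * a / (a^2 + w^2))"
  proof -
    have nz: "of_real a + \<i> * of_real w \<noteq> 0" "of_real a + \<i> * of_real (- w) \<noteq> 0"
      using assms by (auto simp: complex_eq_iff)
    have "(of_real a + \<i> * of_real w) * (of_real a + \<i> * of_real (- w)) = complex_of_real (a^2 + w^2)"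
      by (simp add: power2_eq_square algebra_simps)
    then show ?thesis using nz
      by (simp add: add_frac_eq)
  qed
  ultimately show ?thesis by simp
qed

text \<open>The terms of the series are set to \<open>0\<close> at \<open>t = 0\<close> because \<open>tent 0 = 0\<close> by the conventions
  \<open>1 / 0 = 0\<close> and \<open>ln 0 = 0\<close>.\<close>

lemma tent_fourier:
  "has_bochner_integral lborel (\<lambda>t. complex_of_real (tent t) * exp (- \<i> * of_real (w * t)))
     (complex_of_real (tent_hat w))"
proof -
  define c where "c k = 4 / pi / (2 * real k + 1)" for k :: nat
  define a where "a k = (2 * real k + 1) * pi" for k :: nat
  define f where "f w k t = of_real (c k) * (if t = 0 then 0 else exp (- of_real (a k * \<bar>t\<bar>) - \<i> * of_real (w * t)))"
    for w k t
  have a_pos: "a k > 0" for k by (simp add: a_def)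
  have c_pos: "c k > 0" for k by (simp add: c_def)
  have f: "has_bochner_integral lborel (f w k) (of_real (8 / ((a k)^2 + w^2)))" for w k
  proof -
    have "has_bochner_integral lborel (f w k) (of_real (c k) * of_real (2 * a k / (a k ^ 2 + w ^ 2)))"
      unfolding f_def by (intro has_bochner_integral_mult_right has_bochner_integral_exp_abs a_pos)
    moreover have "c k * (2 * a k / (a k ^ 2 + w ^ 2)) = 8 / ((a k)^2 + w^2)"
      by (simp add: c_def a_def)
    ultimately show ?thesis by (metis of_real_mult)
  qed
  \<comment> \<open>Taking the modulus removes the phase, so the L1 norm of a term is its integral
    at frequency \<open>0\<close>. Those norms are summable by the series for
    \<open>tent_hat 0\<close>, which justifies integrating term by term.\<close>
  have norm_f: "norm (f w k t) = Re (f 0 k t)" for k t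
    using c_pos[of k] by (simp add: f_def norm_mult Re_exp)
  have norm_real: "norm (f w k t) = c k * (if t = 0 then 0 else exp (- (a k) * \<bar>t\<bar>))" for k t
    using c_pos[of k] by (simp add: f_def norm_mult)
  have sums_norm: "(\<lambda>k. norm (f w k t)) sums tent t" for t
  proof (cases "t = 0")
    case False
    then show ?thesis using tent_sums[OF False] by (simp add: norm_real c_def a_def)
  qed (simp add: norm_real tent_def coth_def)
  have suminf_f: "(\<Sum>k. f w k t) = complex_of_real (tent t) * exp (- \<i> * of_real (w * t))" for t
  proof -
    have "(\<lambda>k. of_real (norm (f w k t)) * exp (- \<i> * of_real (w * t))) sums
       (of_real (tent t) * exp (- \<i> * of_real (w * t)))"
      by (intro sums_mult2) (simp add: sums_of_real_iff sums_norm)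
    moreover have "of_real (norm (f w k t)) * exp (- \<i> * of_real (w * t)) = f w k t" for k
      by (subst norm_real) (simp add: f_def exp_diff exp_minus field_simps flip: exp_of_real)
    ultimately show ?thesis by (simp add: sums_iff)
  qed
  have int: "integrable lborel (f w k)" for k using f by (rule integrable.intros)
  have ae: "AE t in lborel. summable (\<lambda>k. norm (f w k t))"
    using sums_norm by (simp add: sums_iff)
  have "integral\<^sup>L lborel (\<lambda>t. norm (f w k t)) = 8 / ((a k)^2 + 0^2)" for k
  proof -
    have "integral\<^sup>L lborel (\<lambda>t. norm (f w k t)) = Re (integral\<^sup>L lborel (f 0 k))"
      unfolding norm_f using f[of 0 k] by (subst integral_Re) (auto simp: has_bochner_integral_iff)
    then show ?thesis using f[of 0 k] by (simp add: has_bochner_integral_iff)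
  qed
  then have summ: "summable (\<lambda>k. integral\<^sup>L lborel (\<lambda>t. norm (f w k t)))"
    using tent_hat_sums[of 0] by (simp add: sums_iff a_def)
  have "integrable lborel (\<lambda>t. \<Sum>k. f w k t)" by (rule integrable_suminf[OF int ae summ])
  moreover have "(\<lambda>k. integral\<^sup>L lborel (f w k)) sums integral\<^sup>L lborel (\<lambda>t. \<Sum>k. f w k t)"
    by (rule sums_integral[OF int ae summ])
  moreover have "(\<lambda>k. integral\<^sup>L lborel (f w k)) sums of_real (tent_hat w)"
    using f[of w] tent_hat_sums[of w]
    by (simp add: has_bochner_integral_iff a_def sums_of_real_iff del: of_real_divide)
  ultimately show ?thesis
    using sums_unique2 unfolding suminf_f has_bochner_integral_iff by blast
qed

section \<open>Diagonalisation of Hermitian matrices\<close>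

definition dg :: "nat \<Rightarrow> (nat \<Rightarrow> complex) \<Rightarrow> complex mat" where
  "dg n f = mat n n (\<lambda>(a,b). if a = b then f a else 0)"

lemma dg_carrier [simp]: "dg n f \<in> carrier_mat n n"
  and dg_index [simp]: "a < n \<Longrightarrow> b < n \<Longrightarrow> dg n f $$ (a,b) = (if a = b then f a else 0)"
  and dg_dim [simp]: "dim_row (dg n f) = n" "dim_col (dg n f) = n"
  by (auto simp: dg_def)

lemma hermitian_adjoint_inner:
  assumes "hermitian n A" "v \<in> carrier_vec n" "w \<in> carrier_vec n"
  shows "(A *\<^sub>v v) \<bullet>c w = v \<bullet>c (A *\<^sub>v w)"
proof -
  have A: "A \<in> carrier_mat n n" and "adj A = A" using assms by (auto simp: hermitian_def)
  then have c: "cnj (A $$ (a,b)) = A $$ (b,a)" if "a < n" "b < n" for a b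
    using that by (metis adj_def carrier_matD index_mat(1) case_prod_conv)
  have "(A *\<^sub>v v) \<bullet>c w = (\<Sum>a<n. \<Sum>b<n. A $$ (a,b) * vec_index v b * cnj (vec_index w a))"
    using A assms by (simp add: scalar_prod_def sum_distrib_right lessThan_atLeast0)
  also have "\<dots> = (\<Sum>b<n. \<Sum>a<n. A $$ (a,b) * vec_index v b * cnj (vec_index w a))"
    by (rule sum.swap)
  also have "\<dots> = v \<bullet>c (A *\<^sub>v w)"
    using A assms by (simp add: scalar_prod_def sum_distrib_left lessThan_atLeast0 c mult_ac)
  finally show ?thesis .
qed

lemma hermitian_eigenvalue_real:
  assumes "hermitian n A" "eigenvector A v e"
  shows "e \<in> \<real>"
proof -
  have v: "v \<in> carrier_vec n" "v \<noteq> 0\<^sub>v n" "A *\<^sub>v v = e \<cdot>\<^sub>v v"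
    using assms by (auto simp: eigenvector_def hermitian_def)
  have "e * (v \<bullet>c v) = cnj e * (v \<bullet>c v)"
    using hermitian_adjoint_inner[OF assms(1) v(1) v(1)] v
    by (simp add: v(3) conjugate_smult_vec)
  moreover have "v \<bullet>c v \<noteq> 0" using v by simp
  ultimately have "cnj e = e" by simp
  then show ?thesis by (simp add: Reals_cnj_iff)
qed

text \<open>Let \<open>w\<close> be \<open>A - e\<close> applied to \<open>v\<close>. If
  \<open>w\<close> were nonzero it would be an eigenvector, so \<open>e\<close> would be real and
  \<open>A - e\<close> self-adjoint; moving \<open>A - e\<close> across the inner product of
  \<open>w\<close> with itself then gives \<open>0\<close>. This excludes Jordan chains of length
  two.\<close>

lemma hermitian_char_matrix_square:
  assumes H: "hermitian n A" and v: "v \<in> carrier_vec n"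
    and 0: "char_matrix A e *\<^sub>v (char_matrix A e *\<^sub>v v) = 0\<^sub>v n"
  shows "char_matrix A e *\<^sub>v v = 0\<^sub>v n"
proof (rule ccontr)
  let ?w = "char_matrix A e *\<^sub>v v"
  assume nz: "?w \<noteq> 0\<^sub>v n"
  have A: "A \<in> carrier_mat n n" using H by (simp add: hermitian_def)
  then have w: "?w \<in> carrier_vec n" using v by (intro mult_mat_vec_carrier[of _ n n]) auto
  have ev: "eigenvector A ?w e"
    unfolding eigenvector_char_matrix[OF A] using 0 nz w by simp
  then have "e \<in> \<real>" by (rule hermitian_eigenvalue_real[OF H])
  then have e: "cnj e = e" by (simp add: Reals_cnj_iff)
  have Aw: "A *\<^sub>v ?w = e \<cdot>\<^sub>v ?w" using ev by (simp add: eigenvector_def)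
  have w_eq: "?w = A *\<^sub>v v + (- e) \<cdot>\<^sub>v v"
    unfolding char_matrix_def using A v
    by (intro eq_vecI) (auto simp: add_scalar_prod_distrib[of _ n])
  have "?w \<bullet>c ?w = (A *\<^sub>v v) \<bullet>c ?w + (- e) * (v \<bullet>c ?w)"
    using A v w by (subst (1) w_eq) (simp add: add_scalar_prod_distrib[of _ n])
  also have "(A *\<^sub>v v) \<bullet>c ?w = e * (v \<bullet>c ?w)"
    using hermitian_adjoint_inner[OF H v w] w v by (simp add: Aw conjugate_smult_vec e)
  finally have "?w \<bullet>c ?w = 0" by simp
  then show False using w nz by simp
qed

text \<open>Lets an equality of total eigenspace dimensions be read block by block in the Jordan
  form.\<close>

lemma sum_list_eq_imp_pointwise_eq:
  fixes f g :: "'a \<Rightarrow> nat"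
  assumes "(\<Sum>x\<leftarrow>xs. f x) = (\<Sum>x\<leftarrow>xs. g x)" "\<And>x. f x \<le> g x" "x \<in> set xs"
  shows "f x = g x"
  using assms(1,3)
proof (induction xs)
  case (Cons y ys)
  have "(\<Sum>x\<leftarrow>ys. f x) \<le> (\<Sum>x\<leftarrow>ys. g x)" by (intro sum_list_mono assms(2))
  with Cons assms(2)[of y] show ?case by auto
qed simp

lemma diagonal_jordan_matrix:
  "\<forall>(m,a)\<in>set n_as. m = 1 \<Longrightarrow> diagonal_mat (jordan_matrix n_as)"
proof (induction n_as)
  case Nil
  then show ?case by (simp add: jordan_matrix_def diagonal_mat_def)
next
  case (Cons na n_as)
  obtain a where na: "na = (1, a)" using Cons.prems by (cases na) auto
  have "jordan_matrix (na # n_as) = four_block_mat (jordan_block 1 a)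
      (0\<^sub>m 1 (dim_col (jordan_matrix n_as))) (0\<^sub>m (dim_row (jordan_matrix n_as)) 1) (jordan_matrix n_as)"
    unfolding na jordan_matrix_def by (simp add: Let_def)
  with Cons show ?case by (auto simp: diagonal_mat_def)
qed

text \<open>Take a complex Jordan form. The kernels of \<open>A - e\<close> and of its square agree
  for every \<open>e\<close>, so all blocks have size one, and the diagonal entries are eigenvalues,
  hence real. The Jordan form yields an inverse \<open>Q\<close> of \<open>P\<close> rather than an
  orthonormal basis.\<close>

lemma hermitian_diagonalizable:
  assumes H: "hermitian n A"
  obtains P Q \<mu> where "P \<in> carrier_mat n n" "Q \<in> carrier_mat n n" "P * Q = 1\<^sub>m n" "Q * P = 1\<^sub>m n"
    "A = P * dg n (\<lambda>a. complex_of_real (\<mu> a)) * Q"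
proof -
  have A: "A \<in> carrier_mat n n" using H by (simp add: hermitian_def)
  obtain as where "char_poly A = (\<Prod>a\<leftarrow>as. [:- a, 1:])" using char_poly_factorized[OF A] by auto
  then obtain n_as where jnf: "jordan_nf A n_as" using jordan_nf_exists[OF A] by blast
  have ker: "mat_kernel (char_matrix A e ^\<^sub>m 2) = mat_kernel (char_matrix A e ^\<^sub>m 1)" for e
  proof -
    let ?C = "char_matrix A e"
    have C: "?C \<in> carrier_mat n n" using A by simp
    have C2: "?C ^\<^sub>m 2 = ?C * ?C" and C1: "?C ^\<^sub>m 1 = ?C"
      using C by (simp_all add: numeral_2_eq_2 carrier_matD[OF C])
    have "mat_kernel (?C * ?C) = mat_kernel ?C"
    proof (rule subset_antisym)
      show "mat_kernel ?C \<subseteq> mat_kernel (?C * ?C)" by (rule mat_kernel_mult_subset[OF C C])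
      show "mat_kernel (?C * ?C) \<subseteq> mat_kernel ?C"
      proof
        fix v assume "v \<in> mat_kernel (?C * ?C)"
        then have v: "v \<in> carrier_vec n" "?C * ?C *\<^sub>v v = 0\<^sub>v n"
          using mat_kernelD[of "?C * ?C" n n] C by auto
        then have "?C *\<^sub>v (?C *\<^sub>v v) = 0\<^sub>v n" using C by (simp add: assoc_mult_mat_vec[of _ n n])
        from hermitian_char_matrix_square[OF H v(1) this] show "v \<in> mat_kernel ?C"
          using C v by (intro mat_kernelI[of _ n n]) auto
      qed
    qed
    then show ?thesis unfolding C2 C1 .
  qed
  have dim: "dim_gen_eigenspace A e 2 = dim_gen_eigenspace A e 1" for e
    unfolding dim_gen_eigenspace_def kernel_dim_def ker
    using A by simp
  have one: "m = 1" if ma: "(m, e) \<in> set n_as" for m e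
  proof -
    have m: "m \<in> set (map fst [(n, e')\<leftarrow>n_as . e' = e])" using ma by force
    \<comment> \<open>A block of size \<open>m\<close> at \<open>e\<close> adds
      \<open>min k m\<close> to the dimension of the generalised eigenspace of order
      \<open>k\<close>; equal dimensions for \<open>k = 1\<close> and \<open>k = 2\<close> force
      equality in each block.\<close>
    have "min 1 m = min 2 m"
      using sum_list_eq_imp_pointwise_eq[OF _ _ m, of "min 1" "min 2"]
        dim[of e] unfolding dim_gen_eigenspace[OF jnf] by simp
    moreover have "m \<noteq> 0" using jnf ma by (force simp: jordan_nf_def)
    ultimately show ?thesis by (simp add: min_def split: if_splits)
  qed
  then have diag: "diagonal_mat (jordan_matrix n_as)" by (intro diagonal_jordan_matrix) auto
  obtain P Q where "similar_mat_wit A (jordan_matrix n_as) P Q"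
    using jnf by (auto simp: jordan_nf_def similar_mat_def)
  note PQ = similar_mat_witD2[OF A this]
  define B where "B = jordan_matrix n_as"
  have B: "B \<in> carrier_mat n n" using PQ by (simp add: B_def)
  have ev: "eigenvector A (col P a) (B $$ (a,a))" if a: "a < n" for a
  proof -
    have "A * P = P * B"
      using PQ B by (simp add: B_def[symmetric] assoc_mult_mat[of _ n n _ n _ n])
    then have "A *\<^sub>v col P a = col (P * B) a"
      using PQ A a by (metis col_mult2)
    also have "\<dots> = P *\<^sub>v col B a" using PQ B a by (intro col_mult2) auto
    also have "col B a = B $$ (a,a) \<cdot>\<^sub>v unit_vec n a"
      using diag a B by (intro eq_vecI) (auto simp: diagonal_mat_def B_def unit_vec_def)
    also have "P *\<^sub>v (B $$ (a,a) \<cdot>\<^sub>v unit_vec n a) = B $$ (a,a) \<cdot>\<^sub>v (P *\<^sub>v unit_vec n a)"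
      using PQ by (intro mult_mat_vec) auto
    also have "P *\<^sub>v unit_vec n a = col P a"
      using PQ a by (intro eq_vecI) auto
    finally have *: "A *\<^sub>v col P a = B $$ (a,a) \<cdot>\<^sub>v col P a" .
    have "col P a \<noteq> 0\<^sub>v n"
    proof
      assume "col P a = 0\<^sub>v n"
      moreover have "(Q * P) $$ (a,a) = scalar_prod (row Q a) (col P a)"
        using carrier_matD[OF PQ(6)] carrier_matD[OF PQ(7)] a by (intro index_mult_mat) auto
      moreover have "row Q a \<in> carrier_vec n" using PQ(7) a by auto
      ultimately have "(Q * P) $$ (a,a) = 0" by simp
      then show False using PQ a by simp
    qed
    then show ?thesis using * PQ A a by (auto simp: eigenvector_def)
  qed
  have "B = dg n (\<lambda>a. complex_of_real (Re (B $$ (a,a))))"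
    using diag B hermitian_eigenvalue_real[OF H ev]
    by (intro eq_matI) (auto simp: diagonal_mat_def B_def)
  then show ?thesis using that[of P Q "\<lambda>a. Re (B $$ (a,a))"] PQ by (simp add: B_def)
qed

section \<open>The derivative of the matrix exponential\<close>

lemma sandwich_index:
  assumes "P \<in> carrier_mat n n" "X \<in> carrier_mat n n" "Q \<in> carrier_mat n n" "a < n" "b < n"
  shows "(P * X * Q) $$ (a,b) = (\<Sum>k<n. \<Sum>l<n. P $$ (a,k) * X $$ (k,l) * Q $$ (l,b))"
  using assms by (simp add: scalar_prod_def sum_distrib_left lessThan_atLeast0 mult.assoc)

lemma mult_dg_index:
  assumes "X \<in> carrier_mat n n" "a < n" "b < n"
  shows "(X * dg n f) $$ (a,b) = X $$ (a,b) * f b" "(dg n f * X) $$ (a,b) = f a * X $$ (a,b)"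
  using assms by (simp_all add: scalar_prod_def if_distrib[of "\<lambda>x. _ * x"] if_distrib[of "\<lambda>x. x * _"]
      sum.delta' cong: if_cong)

lemma dg_pow: "dg n f ^\<^sub>m m = dg n (\<lambda>a. f a ^ m)"
proof (induction m)
  case 0
  show ?case by (intro eq_matI) auto
next
  case (Suc m)
  then show ?case by (intro eq_matI) (auto simp add: mult_dg_index simp del: index_mult_mat(1))
qed

lemma sandwich_pow:
  assumes "P \<in> carrier_mat n n" "X \<in> carrier_mat n n" "Q \<in> carrier_mat n n" "P * Q = 1\<^sub>m n" "Q * P = 1\<^sub>m n"
  shows "(P * X * Q) ^\<^sub>m m = P * X ^\<^sub>m m * Q"
proof -
  have "similar_mat_wit (P * X * Q) X P Q" using assms by (simp add: similar_mat_wit_def Let_def)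
  then show ?thesis
    using similar_mat_wit_pow[of "P * X * Q" X P Q m] assms by (simp add: similar_mat_wit_def Let_def)
qed

lemma sandwich_add:
  fixes P X Y Q :: "'a::semiring_1 mat"
  assumes "P \<in> carrier_mat n n" "X \<in> carrier_mat n n" "Y \<in> carrier_mat n n" "Q \<in> carrier_mat n n"
  shows "P * X * Q + P * Y * Q = P * (X + Y) * Q"
  using assms by (simp add: mult_add_distrib_mat[of P n n X n Y] add_mult_distrib_mat[of "P * X" n n "P * Y" Q n]
      del: assoc_mult_mat)

lemma sandwich_mult:
  fixes P X Y Q :: "'a::semiring_1 mat"
  assumes "P \<in> carrier_mat n n" "X \<in> carrier_mat n n" "Y \<in> carrier_mat n n" "Q \<in> carrier_mat n n" "Q * P = 1\<^sub>m n"
  shows "(P * X * Q) * (P * Y * Q) = P * (X * Y) * Q"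
proof -
  have "Q * (P * (Y * Q)) = (Q * P) * (Y * Q)"
    using assms by (intro assoc_mult_mat[symmetric, of _ n n _ n _ n]) auto
  also have "\<dots> = Y * Q" using assms by (simp add: left_mult_one_mat[of "Y * Q" n n])
  finally show ?thesis using assms by (simp add: assoc_mult_mat[of _ n n _ n _ n])
qed

text \<open>Each entry after a change of basis is a fixed finite linear combination of the old
  entries, so entrywise convergence carries over. It serves both the exponential series and the
  series of its derivative.\<close>

lemma sandwich_sums:
  fixes P Q Y :: "complex mat"
  assumes "P \<in> carrier_mat n n" "Q \<in> carrier_mat n n" "Y \<in> carrier_mat n n"
    and "\<And>m. X m \<in> carrier_mat n n"
    and "\<And>k l. k < n \<Longrightarrow> l < n \<Longrightarrow> (\<lambda>m. X m $$ (k,l) / of_nat (fact m)) sums Y $$ (k,l)"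
    and "a < n" "b < n"
  shows "(\<lambda>m. (P * X m * Q) $$ (a,b) / of_nat (fact m)) sums (P * Y * Q) $$ (a,b)"
proof -
  have "(\<lambda>m. \<Sum>k<n. \<Sum>l<n. P $$ (a,k) * (X m $$ (k,l) / of_nat (fact m)) * Q $$ (l,b)) sums
     (\<Sum>k<n. \<Sum>l<n. P $$ (a,k) * Y $$ (k,l) * Q $$ (l,b))"
    by (intro sums_sum sums_mult sums_mult2 assms(5)) auto
  moreover have "(P * X m * Q) $$ (a,b) / of_nat (fact m) =
      (\<Sum>k<n. \<Sum>l<n. P $$ (a,k) * (X m $$ (k,l) / of_nat (fact m)) * Q $$ (l,b))" for m
    unfolding sandwich_index[OF assms(1,4,2,6,7)] by (simp add: sum_divide_distrib)
  ultimately show ?thesis unfolding sandwich_index[OF assms(1,3,2,6,7)] by simp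
qed

lemma mexp_diagonalized:
  assumes "P \<in> carrier_mat n n" "Q \<in> carrier_mat n n" "P * Q = 1\<^sub>m n" "Q * P = 1\<^sub>m n"
  shows "mexp (P * dg n f * Q) = P * dg n (\<lambda>a. exp (f a)) * Q"
proof (rule eq_matI)
  fix a b assume ab: "a < dim_row (P * dg n (\<lambda>a. exp (f a)) * Q)" "b < dim_col (P * dg n (\<lambda>a. exp (f a)) * Q)"
  have *: "(\<lambda>m. dg n (\<lambda>a. f a ^ m) $$ (k,l) / of_nat (fact m)) sums dg n (\<lambda>a. exp (f a)) $$ (k,l)"
    if "k < n" "l < n" for k l
    using that exp_converges[of "f k"] by (auto simp: scaleR_conv_of_real divide_inverse mult.commute)
  have "(\<lambda>m. (P * dg n (\<lambda>a. f a ^ m) * Q) $$ (a,b) / of_nat (fact m)) sums (P * dg n (\<lambda>a. exp (f a)) * Q) $$ (a,b)"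
    using ab assms by (intro sandwich_sums *) auto
  then show "mexp (P * dg n f * Q) $$ (a,b) = (P * dg n (\<lambda>a. exp (f a)) * Q) $$ (a,b)"
    using ab assms by (simp add: mexp_def sums_iff sandwich_pow dg_pow del: index_mult_mat(1))
qed (use assms in \<open>auto simp: mexp_def\<close>)

text \<open>The derivative of \<open>z \<mapsto> (X + z Y)\<^sup>m\<close> at \<open>z = 0\<close>, i.e. \<open>\<Sum>\<^sub>a\<^sub><\<^sub>m X\<^sup>a Y X\<^sup>m\<^sup>-\<^sup>1\<^sup>-\<^sup>a\<close>.\<close>

primrec pow_deriv :: "nat \<Rightarrow> complex mat \<Rightarrow> complex mat \<Rightarrow> nat \<Rightarrow> complex mat" where
  "pow_deriv n X Y 0 = 0\<^sub>m n n"
| "pow_deriv n X Y (Suc m) = pow_deriv n X Y m * X + X ^\<^sub>m m * Y"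

lemma pow_deriv_carrier [simp]:
  "X \<in> carrier_mat n n \<Longrightarrow> Y \<in> carrier_mat n n \<Longrightarrow> pow_deriv n X Y m \<in> carrier_mat n n"
  by (induction m) auto

text \<open>Product rule on the last factor. It is stated at every \<open>z\<close>, since
  differentiating the exponential series term by term needs the derivatives on a whole disc.\<close>

lemma has_field_derivative_mat_pow:
  assumes X: "X \<in> carrier_mat n n" and Y: "Y \<in> carrier_mat n n" and "a < n" "b < n"
  shows "((\<lambda>z. ((X + z \<cdot>\<^sub>m Y) ^\<^sub>m m) $$ (a,b)) has_field_derivative pow_deriv n (X + z \<cdot>\<^sub>m Y) Y m $$ (a,b)) (at z within S)"
  using assms(3,4)
proof (induction m arbitrary: a b)
  case 0
  then show ?case using X Y by simp
next
  case (Suc m)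
  have [simp]: "X + z \<cdot>\<^sub>m Y \<in> carrier_mat n n" for z using X Y by simp
  have [simp]: "(X + z \<cdot>\<^sub>m Y) ^\<^sub>m m \<in> carrier_mat n n" for z by (rule pow_carrier_mat) simp
  have [simp]: "pow_deriv n (X + z \<cdot>\<^sub>m Y) Y m \<in> carrier_mat n n" for z using Y by simp
  have "((X + z \<cdot>\<^sub>m Y) ^\<^sub>m Suc m) $$ (a,b) = (\<Sum>k<n. ((X + z \<cdot>\<^sub>m Y) ^\<^sub>m m) $$ (a,k) * (X $$ (k,b) + z * Y $$ (k,b)))" for z
    using X Y Suc.prems carrier_matD[OF \<open>(X + z \<cdot>\<^sub>m Y) ^\<^sub>m m \<in> carrier_mat n n\<close>]
    by (simp add: scalar_prod_def lessThan_atLeast0)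
  moreover have "pow_deriv n (X + z \<cdot>\<^sub>m Y) Y (Suc m) $$ (a,b)
     = (\<Sum>k<n. pow_deriv n (X + z \<cdot>\<^sub>m Y) Y m $$ (a,k) * (X $$ (k,b) + z * Y $$ (k,b))
         + Y $$ (k,b) * ((X + z \<cdot>\<^sub>m Y) ^\<^sub>m m) $$ (a,k))"
    using X Y Suc.prems carrier_matD[OF \<open>(X + z \<cdot>\<^sub>m Y) ^\<^sub>m m \<in> carrier_mat n n\<close>]
      carrier_matD[OF \<open>pow_deriv n (X + z \<cdot>\<^sub>m Y) Y m \<in> carrier_mat n n\<close>]
    by (simp add: scalar_prod_def lessThan_atLeast0 sum.distrib mult.commute)
  moreover have "((\<lambda>z. \<Sum>k<n. ((X + z \<cdot>\<^sub>m Y) ^\<^sub>m m) $$ (a,k) * (X $$ (k,b) + z * Y $$ (k,b))) has_field_derivative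
      (\<Sum>k<n. pow_deriv n (X + z \<cdot>\<^sub>m Y) Y m $$ (a,k) * (X $$ (k,b) + z * Y $$ (k,b))
         + Y $$ (k,b) * ((X + z \<cdot>\<^sub>m Y) ^\<^sub>m m) $$ (a,k))) (at z within S)"
    using Suc.prems by (intro DERIV_sum DERIV_mult Suc.IH) (auto intro!: derivative_eq_intros)
  ultimately show ?case by simp
qed

section \<open>Entrywise bounds and termwise differentiation of the exponential series\<close>

text \<open>The largest entry is submultiplicative up to a factor \<open>n\<close>; that factor is
  attached to \<open>y\<close> so that each induction below gains exactly
  \<open>real n * M\<close>.\<close>

lemma norm_mat_mult_le:
  fixes A B :: "complex mat"
  assumes "A \<in> carrier_mat n n" "B \<in> carrier_mat n n" "a < n" "b < n"
    and "\<And>k l. k < n \<Longrightarrow> l < n \<Longrightarrow> norm (A $$ (k,l)) \<le> x"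
    and "\<And>k l. k < n \<Longrightarrow> l < n \<Longrightarrow> norm (B $$ (k,l)) \<le> y"
  shows "norm ((A * B) $$ (a,b)) \<le> x * (real n * y)"
proof -
  have x: "0 \<le> x" using assms(3,4,5) norm_ge_zero order_trans by blast
  have "norm ((A * B) $$ (a,b)) = norm (\<Sum>k<n. A $$ (a,k) * B $$ (k,b))"
    using assms by (simp add: scalar_prod_def lessThan_atLeast0)
  also have "\<dots> \<le> (\<Sum>k<n. x * y)"
    using assms x by (intro sum_norm_le) (auto simp: norm_mult intro!: mult_mono)
  finally show ?thesis by (simp add: mult_ac)
qed

lemma norm_mat_pow_le:
  fixes X :: "complex mat"
  assumes X: "X \<in> carrier_mat n n" and "\<And>k l. k < n \<Longrightarrow> l < n \<Longrightarrow> norm (X $$ (k,l)) \<le> M"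
    and "a < n" "b < n"
  shows "norm ((X ^\<^sub>m m) $$ (a,b)) \<le> (real n * M) ^ m"
  using assms(3,4)
proof (induction m arbitrary: a b)
  case 0
  then show ?case using X by simp
next
  case (Suc m)
  have "norm ((X ^\<^sub>m m * X) $$ (a,b)) \<le> (real n * M) ^ m * (real n * M)"
    using Suc assms by (intro norm_mat_mult_le pow_carrier_mat) auto
  then show ?case by (simp add: mult_ac)
qed

text \<open>The derivative is a sum of \<open>m\<close> products of \<open>m\<close> factors, each
  product having entries of norm at most \<open>(real n * M) ^ m\<close>.\<close>

lemma norm_pow_deriv_le:
  fixes X Y :: "complex mat"
  assumes X: "X \<in> carrier_mat n n" and Y: "Y \<in> carrier_mat n n"
    and bX: "\<And>k l. k < n \<Longrightarrow> l < n \<Longrightarrow> norm (X $$ (k,l)) \<le> M"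
    and bY: "\<And>k l. k < n \<Longrightarrow> l < n \<Longrightarrow> norm (Y $$ (k,l)) \<le> M"
    and "a < n" "b < n"
  shows "norm (pow_deriv n X Y m $$ (a,b)) \<le> real m * (real n * M) ^ m"
  using assms(5,6)
proof (induction m arbitrary: a b)
  case 0
  then show ?case by simp
next
  case (Suc m)
  have c: "X ^\<^sub>m m \<in> carrier_mat n n" using X by (rule pow_carrier_mat)
  have "norm ((pow_deriv n X Y m * X) $$ (a,b)) \<le> (real m * (real n * M) ^ m) * (real n * M)"
    using Suc X Y bX by (intro norm_mat_mult_le) auto
  moreover have "norm ((X ^\<^sub>m m * Y) $$ (a,b)) \<le> (real n * M) ^ m * (real n * M)"
    using Suc.prems X Y bX bY c by (intro norm_mat_mult_le norm_mat_pow_le) auto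
  moreover have "pow_deriv n X Y (Suc m) $$ (a,b) = (pow_deriv n X Y m * X) $$ (a,b) + (X ^\<^sub>m m * Y) $$ (a,b)"
    using Suc.prems X Y c by (simp del: index_mult_mat(1))
  ultimately have "norm (pow_deriv n X Y (Suc m) $$ (a,b))
      \<le> (real m * (real n * M) ^ m) * (real n * M) + (real n * M) ^ m * (real n * M)"
    by (metis norm_triangle_mono)
  then show ?case by (simp add: algebra_simps)
qed

lemma has_field_derivative_mexp:
  assumes X: "X \<in> carrier_mat n n" and Y: "Y \<in> carrier_mat n n" and ab: "a < n" "b < n"
  shows "((\<lambda>z. mexp (X + z \<cdot>\<^sub>m Y) $$ (a,b)) has_field_derivative
    (\<Sum>m. pow_deriv n X Y m $$ (a,b) / of_nat (fact m))) (at 0)"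
proof -
  \<comment> \<open>A crude constant bounding every entry of \<open>Y\<close> and, uniformly for
    \<open>z\<close> in the unit disc, every entry of \<open>X + z Y\<close>.\<close>
  define M where "M = (\<Sum>k<n. \<Sum>l<n. norm (X $$ (k,l)) + norm (Y $$ (k,l)))"
  have M: "norm (X $$ (k,l)) + norm (Y $$ (k,l)) \<le> M" if "k < n" "l < n" for k l
  proof -
    have "norm (X $$ (k,l)) + norm (Y $$ (k,l)) \<le> (\<Sum>l<n. norm (X $$ (k,l)) + norm (Y $$ (k,l)))"
      using that by (intro member_le_sum) auto
    also have "\<dots> \<le> M" unfolding M_def
      using that by (intro member_le_sum[where f = "\<lambda>k. \<Sum>l<n. norm (X $$ (k,l)) + norm (Y $$ (k,l))"] sum_nonneg) auto
    finally show ?thesis .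
  qed
  have bY: "norm (Y $$ (k,l)) \<le> M" if "k < n" "l < n" for k l
    using M[OF that] by (smt (verit) norm_ge_zero)
  have bX: "norm ((X + z \<cdot>\<^sub>m Y) $$ (k,l)) \<le> M" if "k < n" "l < n" "z \<in> ball 0 1" for k l z
  proof -
    have "norm (X $$ (k,l) + z * Y $$ (k,l)) \<le> norm (X $$ (k,l)) + norm z * norm (Y $$ (k,l))"
      by (metis norm_mult norm_triangle_ineq)
    also have "norm z * norm (Y $$ (k,l)) \<le> 1 * norm (Y $$ (k,l))"
      using that by (intro mult_right_mono) auto
    finally show ?thesis using M[OF that(1,2)] that X Y by simp
  qed
  have c: "X + z \<cdot>\<^sub>m Y \<in> carrier_mat n n" for z using X Y by simp
  \<comment> \<open>The majorant for the Weierstrass test: shifted by one index it is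
    \<open>real n * M\<close> times an exponential series.\<close>
  have s: "summable (\<lambda>m. real m * (real n * M) ^ m / fact m)"
  proof -
    have "summable (\<lambda>m. real (Suc m) * (real n * M) ^ Suc m / fact (Suc m))"
    proof -
      have "real (Suc m) * (real n * M) ^ Suc m / fact (Suc m) = (real n * M) * ((real n * M) ^ m / fact m)" for m
        by (simp add: divide_simps del: of_nat_Suc)
      then show ?thesis
        using summable_exp[of "real n * M"] by (simp only: divide_inverse mult.commute summable_mult)
    qed
    then show ?thesis by (subst (asm) summable_Suc_iff)
  qed
  have "((\<lambda>z. \<Sum>m. ((X + z \<cdot>\<^sub>m Y) ^\<^sub>m m) $$ (a,b) / of_nat (fact m)) has_field_derivative
    (\<Sum>m. pow_deriv n (X + 0 \<cdot>\<^sub>m Y) Y m $$ (a,b) / of_nat (fact m))) (at 0)"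
  proof (rule has_field_derivative_series'(2)[where S = "ball 0 1" and x0 = 0])
    show "((\<lambda>z. ((X + z \<cdot>\<^sub>m Y) ^\<^sub>m m) $$ (a,b) / of_nat (fact m)) has_field_derivative
      pow_deriv n (X + z \<cdot>\<^sub>m Y) Y m $$ (a,b) / of_nat (fact m)) (at z within ball 0 1)" for m z
      by (intro DERIV_cdivide has_field_derivative_mat_pow X Y ab)
    show "uniformly_convergent_on (ball 0 1) (\<lambda>N z. \<Sum>m<N. pow_deriv n (X + z \<cdot>\<^sub>m Y) Y m $$ (a,b) / of_nat (fact m))"
    proof (rule Weierstrass_m_test'[OF _ s])
      fix m and z :: complex assume "z \<in> ball 0 1"
      then have "norm (pow_deriv n (X + z \<cdot>\<^sub>m Y) Y m $$ (a,b)) \<le> real m * (real n * M) ^ m"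
        by (intro norm_pow_deriv_le c Y bX bY ab)
      then show "norm (pow_deriv n (X + z \<cdot>\<^sub>m Y) Y m $$ (a,b) / of_nat (fact m)) \<le> real m * (real n * M) ^ m / fact m"
        by (simp add: norm_divide divide_right_mono)
    qed
    show "summable (\<lambda>m. ((X + 0 \<cdot>\<^sub>m Y) ^\<^sub>m m) $$ (a,b) / of_nat (fact m))"
    proof (rule summable_comparison_test')
      show "summable (\<lambda>m. (real n * M) ^ m / fact m)"
        using summable_exp_generic[of "real n * M"] by (simp add: divide_inverse mult_ac)
      have "norm (((X + 0 \<cdot>\<^sub>m Y) ^\<^sub>m m) $$ (a,b)) \<le> (real n * M) ^ m" for m
        by (intro norm_mat_pow_le c bX ab) auto
      then show "norm (((X + 0 \<cdot>\<^sub>m Y) ^\<^sub>m m) $$ (a,b) / of_nat (fact m)) \<le> (real n * M) ^ m / fact m" for m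
        by (simp add: norm_divide divide_right_mono)
    qed
  qed (auto simp: interior_open)
  moreover have "X + 0 \<cdot>\<^sub>m Y = X" using X Y by (intro eq_matI) auto
  ultimately show ?thesis using X Y ab by (simp add: mexp_def)
qed

section \<open>Divided differences and the derivative of the exponential in an eigenbasis\<close>

text \<open>The first divided difference of \<open>exp\<close>, with its confluent value on the
  diagonal.\<close>

definition exp_dd :: "complex \<Rightarrow> complex \<Rightarrow> complex" where
  "exp_dd x y = (if x = y then exp x else (exp x - exp y) / (x - y))"

text \<open>The divided difference of the \<open>m\<close>-th power, i.e. the sum of
  \<open>x ^ a * y ^ (m - 1 - a)\<close> over \<open>a < m\<close>. The recursion copies that of
  \<open>pow_deriv\<close>.\<close>

primrec pow_dd :: "complex \<Rightarrow> complex \<Rightarrow> nat \<Rightarrow> complex" where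
  "pow_dd x y 0 = 0"
| "pow_dd x y (Suc m) = pow_dd x y m * y + x ^ m"

lemma pow_dd_sums: "(\<lambda>m. pow_dd x y m / of_nat (fact m)) sums exp_dd x y"
proof -
  have e: "(\<lambda>m. z ^ m / of_nat (fact m)) sums exp z" for z :: complex
    using exp_converges[of z] by (simp add: scaleR_conv_of_real divide_inverse mult.commute)
  show ?thesis
  proof (cases "x = y")
    case True
    \<comment> \<open>The term of index \<open>0\<close> vanishes, so the series is treated from
      index \<open>1\<close> on, where cancelling \<open>Suc m\<close> gives back the exponential
      series.\<close>
    have d: "pow_dd x x (Suc m) = of_nat (Suc m) * x ^ m" for m
      by (induction m) (simp_all add: algebra_simps)
    have "pow_dd x x (Suc m) / of_nat (fact (Suc m)) = x ^ m / of_nat (fact m)" for m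
      unfolding d fact_Suc of_nat_mult of_nat_id by (rule mult_divide_mult_cancel_left) (simp del: of_nat_Suc)
    then have "(\<lambda>m. pow_dd x x (Suc m) / of_nat (fact (Suc m))) sums exp x" using e[of x] by simp
    then show ?thesis using True by (subst (asm) sums_Suc_iff) (simp add: exp_dd_def)
  next
    case False
    have "pow_dd x y m * (x - y) = x ^ m - y ^ m" for m
    proof (induction m)
      case (Suc m)
      have "pow_dd x y (Suc m) * (x - y) = (pow_dd x y m * (x - y)) * y + x ^ m * (x - y)"
        by (simp add: algebra_simps)
      then show ?case unfolding Suc by (simp add: algebra_simps)
    qed simp
    then have d: "pow_dd x y m = (x ^ m - y ^ m) / (x - y)" for m using False by (simp add: field_simps)
    have "(\<lambda>m. (x ^ m / of_nat (fact m) - y ^ m / of_nat (fact m)) / (x - y)) sums ((exp x - exp y) / (x - y))"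
      by (intro sums_divide sums_diff e)
    then show ?thesis using False by (simp add: d exp_dd_def diff_divide_distrib mult_ac)
  qed
qed

text \<open>In the eigenbasis, multiplication by a power of \<open>X\<close> on the left or right
  scales entry \<open>(k,l)\<close> by a power of \<open>x k\<close> or \<open>x l\<close>; the sum
  of these scalings is the divided difference.\<close>

lemma pow_deriv_diagonalized:
  assumes P: "P \<in> carrier_mat n n" and Q: "Q \<in> carrier_mat n n" and PQ: "P * Q = 1\<^sub>m n" "Q * P = 1\<^sub>m n"
    and Y: "Y \<in> carrier_mat n n"
  shows "pow_deriv n (P * dg n x * Q) (P * Y * Q) m = P * mat n n (\<lambda>(k,l). pow_dd (x k) (x l) m * Y $$ (k,l)) * Q"
proof (induction m)
  case 0
  have Z: "mat n n (\<lambda>(k,l). pow_dd (x k) (x l) 0 * Y $$ (k,l)) = 0\<^sub>m n n" by (intro eq_matI) auto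
  show ?case unfolding Z using P Q by simp
next
  case (Suc m)
  let ?E = "\<lambda>m. mat n n (\<lambda>(k,l). pow_dd (x k) (x l) m * Y $$ (k,l))"
  have E: "?E m \<in> carrier_mat n n" for m by simp
  have "pow_deriv n (P * dg n x * Q) (P * Y * Q) (Suc m)
     = P * ?E m * Q * (P * dg n x * Q) + P * dg n (\<lambda>a. x a ^ m) * Q * (P * Y * Q)"
    using P Q PQ by (simp add: Suc sandwich_pow dg_pow)
  also have "\<dots> = P * (?E m * dg n x) * Q + P * (dg n (\<lambda>a. x a ^ m) * Y) * Q"
    unfolding sandwich_mult[OF P E dg_carrier Q PQ(2)] sandwich_mult[OF P dg_carrier Y Q PQ(2)] ..
  also have "\<dots> = P * (?E m * dg n x + dg n (\<lambda>a. x a ^ m) * Y) * Q"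
    using Y by (intro sandwich_add[OF P _ _ Q] mult_carrier_mat[OF E dg_carrier] mult_carrier_mat[OF dg_carrier])
  also have "?E m * dg n x + dg n (\<lambda>a. x a ^ m) * Y = ?E (Suc m)"
    using Y by (intro eq_matI) (auto simp: mult_dg_index algebra_simps simp del: index_mult_mat(1))
  finally show ?case .
qed

text \<open>The Daleckii-Krein formula for the exponential: in an eigenbasis of the base point, the
  derivative is the entrywise product of the direction with the divided differences.\<close>

lemma has_field_derivative_mexp_diagonalized:
  assumes P: "P \<in> carrier_mat n n" and Q: "Q \<in> carrier_mat n n" and PQ: "P * Q = 1\<^sub>m n" "Q * P = 1\<^sub>m n"
    and Y: "Y \<in> carrier_mat n n" and ab: "a < n" "b < n"
  shows "((\<lambda>z. mexp (P * dg n x * Q + z \<cdot>\<^sub>m Y) $$ (a,b)) has_field_derivative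
    (P * mat n n (\<lambda>(k,l). exp_dd (x k) (x l) * (Q * Y * P) $$ (k,l)) * Q) $$ (a,b)) (at 0)"
proof -
  define Y' where "Y' = Q * Y * P"
  have Y': "Y' \<in> carrier_mat n n" using P Q Y by (simp add: Y'_def)
  have "P * Y' * Q = (P * Q) * Y * (P * Q)" unfolding Y'_def
    using P Q Y by (simp only: assoc_mult_mat[of _ n n _ n _ n] mult_carrier_mat[of _ n n _ n])
  then have YY: "P * Y' * Q = Y" using PQ Y by simp
  have "(\<lambda>m. (P * mat n n (\<lambda>(k,l). pow_dd (x k) (x l) m * Y' $$ (k,l)) * Q) $$ (a,b) / of_nat (fact m)) sums
    (P * mat n n (\<lambda>(k,l). exp_dd (x k) (x l) * Y' $$ (k,l)) * Q) $$ (a,b)"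
  proof (intro sandwich_sums)
    fix k l assume "k < n" "l < n"
    then show "(\<lambda>m. mat n n (\<lambda>(k,l). pow_dd (x k) (x l) m * Y' $$ (k,l)) $$ (k,l) / of_nat (fact m)) sums
       mat n n (\<lambda>(k,l). exp_dd (x k) (x l) * Y' $$ (k,l)) $$ (k,l)"
      using sums_mult2[OF pow_dd_sums[of "x k" "x l"], of "Y' $$ (k,l)"] by simp
  qed (use P Q ab in auto)
  then have "(\<lambda>m. pow_deriv n (P * dg n x * Q) Y m $$ (a,b) / of_nat (fact m)) sums
    (P * mat n n (\<lambda>(k,l). exp_dd (x k) (x l) * Y' $$ (k,l)) * Q) $$ (a,b)"
    using pow_deriv_diagonalized[OF P Q PQ Y', of x] unfolding YY by simp
  then have S: "(\<Sum>m. pow_deriv n (P * dg n x * Q) Y m $$ (a,b) / of_nat (fact m)) =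
    (P * mat n n (\<lambda>(k,l). exp_dd (x k) (x l) * Y' $$ (k,l)) * Q) $$ (a,b)"
    by (rule sums_unique[symmetric])
  have "P * dg n x * Q \<in> carrier_mat n n" using P Q by (intro mult_carrier_mat[of _ n n]) auto
  from has_field_derivative_mexp[OF this Y ab] show ?thesis
    unfolding S Y'_def .
qed

section \<open>Gibbs states\<close>

lemma mtrace_mult_commute:
  assumes "A \<in> carrier_mat n n" "B \<in> carrier_mat n n"
  shows "mtrace (A * B) = mtrace (B * A)"
proof -
  have "mtrace (A * B) = (\<Sum>k<n. \<Sum>l<n. A $$ (k,l) * B $$ (l,k))"
    using assms by (simp add: mtrace_def scalar_prod_def lessThan_atLeast0)
  also have "\<dots> = (\<Sum>l<n. \<Sum>k<n. A $$ (k,l) * B $$ (l,k))" by (rule sum.swap)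
  also have "\<dots> = mtrace (B * A)"
    using assms by (simp add: mtrace_def scalar_prod_def lessThan_atLeast0 mult.commute)
  finally show ?thesis .
qed

lemma mtrace_sandwich:
  assumes "P \<in> carrier_mat n n" "X \<in> carrier_mat n n" "Q \<in> carrier_mat n n" "Q * P = 1\<^sub>m n"
  shows "mtrace (P * X * Q) = mtrace X"
proof -
  have "mtrace (P * X * Q) = mtrace (Q * (P * X))"
    using assms by (intro mtrace_mult_commute[of _ n]) auto
  also have "Q * (P * X) = (Q * P) * X" using assms by (intro assoc_mult_mat[symmetric, of _ n n _ n _ n])
  finally show ?thesis using assms by simp
qed

lemma smult_sandwich_dg:
  assumes "P \<in> carrier_mat n n" "Q \<in> carrier_mat n n"
  shows "c \<cdot>\<^sub>m (P * dg n f * Q) = P * dg n (\<lambda>a. c * f a) * Q"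
proof (rule eq_matI)
  fix a b assume "a < dim_row (P * dg n (\<lambda>a. c * f a) * Q)" "b < dim_col (P * dg n (\<lambda>a. c * f a) * Q)"
  then have ab: "a < n" "b < n" using assms by auto
  have "(c \<cdot>\<^sub>m (P * dg n f * Q)) $$ (a,b) = c * (P * dg n f * Q) $$ (a,b)"
    using ab assms by simp
  also have "\<dots> = (P * dg n (\<lambda>a. c * f a) * Q) $$ (a,b)"
    unfolding sandwich_index[OF assms(1) dg_carrier assms(2) ab] sum_distrib_left
    by (intro sum.cong) auto
  finally show "(c \<cdot>\<^sub>m (P * dg n f * Q)) $$ (a,b) = (P * dg n (\<lambda>a. c * f a) * Q) $$ (a,b)" .
qed (use assms in auto)

text \<open>Carries a linear relation between entries in the eigenbasis back to the original basis,
  as needed after the quotient rule for the Gibbs state.\<close>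

lemma sandwich_linear:
  fixes P A B C Q :: "complex mat"
  assumes P: "P \<in> carrier_mat n n" and "A \<in> carrier_mat n n" "B \<in> carrier_mat n n" "C \<in> carrier_mat n n"
    and Q: "Q \<in> carrier_mat n n"
    and eq: "\<And>k l. k < n \<Longrightarrow> l < n \<Longrightarrow> A $$ (k,l) + r * B $$ (k,l) = s * C $$ (k,l)"
    and ab: "a < n" "b < n"
  shows "(P * A * Q) $$ (a,b) + r * (P * B * Q) $$ (a,b) = s * (P * C * Q) $$ (a,b)"
proof -
  have "(P * A * Q) $$ (a,b) + r * (P * B * Q) $$ (a,b)
      = (\<Sum>k<n. \<Sum>l<n. P $$ (a,k) * A $$ (k,l) * Q $$ (l,b) + r * (P $$ (a,k) * B $$ (k,l) * Q $$ (l,b)))"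
    unfolding sandwich_index[OF P assms(2) Q ab] sandwich_index[OF P assms(3) Q ab]
    by (simp only: sum_distrib_left sum.distrib)
  also have "\<dots> = (\<Sum>k<n. \<Sum>l<n. s * (P $$ (a,k) * C $$ (k,l) * Q $$ (l,b)))"
  proof (intro sum.cong refl)
    fix k l assume "k \<in> {..<n}" "l \<in> {..<n}"
    then have "A $$ (k,l) + r * B $$ (k,l) = s * C $$ (k,l)" by (intro eq) auto
    from arg_cong[OF this, of "\<lambda>x. P $$ (a,k) * x * Q $$ (l,b)"]
    show "P $$ (a,k) * A $$ (k,l) * Q $$ (l,b) + r * (P $$ (a,k) * B $$ (k,l) * Q $$ (l,b))
        = s * (P $$ (a,k) * C $$ (k,l) * Q $$ (l,b))" by (simp add: algebra_simps)
  qed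
  also have "\<dots> = s * (P * C * Q) $$ (a,b)"
    unfolding sandwich_index[OF P assms(4) Q ab] sum_distrib_left ..
  finally show ?thesis .
qed

lemma conj_sandwich:
  assumes "P \<in> carrier_mat n n" "X \<in> carrier_mat n n" "Q \<in> carrier_mat n n" "P * Q = 1\<^sub>m n" "Q * P = 1\<^sub>m n"
  shows "P * (Q * X * P) * Q = (X :: 'a::semiring_1 mat)"
proof -
  have "P * (Q * X * P) = P * (Q * (X * P))"
    using assms by (simp add: assoc_mult_mat[of _ n n _ n _ n])
  also have "\<dots> = P * Q * (X * P)" using assms by (intro assoc_mult_mat[symmetric, of _ n n _ n _ n]) auto
  also have "\<dots> = X * P" unfolding assms(4) using assms by (intro left_mult_one_mat[of _ n n]) auto
  finally have "P * (Q * X * P) * Q = X * P * Q" by simp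
  also have "\<dots> = X * (P * Q)" using assms by (intro assoc_mult_mat[of _ n n _ n _ n])
  finally show ?thesis using assms by simp
qed

text \<open>Diagonalise \<open>H = P diag(\<mu>) Q\<close>. The change of basis \<open>W = Q U\<close> satisfies
  \<open>e\<^sup>-\<^sup>\<mu>\<^sup>a / z \<cdot> W\<^sub>a\<^sub>b = W\<^sub>a\<^sub>b \<cdot> lam\<^sub>b\<close>; wherever \<open>W\<^sub>a\<^sub>b \<noteq> 0\<close> one may take logarithms, so \<open>W\<close> also
  intertwines \<open>- \<mu>\<close> with \<open>ln (z lam)\<close>.\<close>

lemma gibbs_log:
  assumes H: "hermitian n H" and n: "n > 0"
    and U: "U \<in> carrier_mat n n" and V: "V \<in> carrier_mat n n" and UV: "U * V = 1\<^sub>m n" "V * U = 1\<^sub>m n"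
    and eq: "(1 / mtrace (mexp (- H))) \<cdot>\<^sub>m mexp (- H) = U * dg n (\<lambda>a. complex_of_real (lam a)) * V"
  obtains z where "z > 0" "mtrace (mexp (- H)) = complex_of_real z" "\<And>a. a < n \<Longrightarrow> lam a > 0"
    "- H = U * dg n (\<lambda>a. complex_of_real (ln (z * lam a))) * V"
proof -
  obtain P Q \<mu> where P: "P \<in> carrier_mat n n" and Q: "Q \<in> carrier_mat n n"
    and PQ: "P * Q = 1\<^sub>m n" "Q * P = 1\<^sub>m n" and HP: "H = P * dg n (\<lambda>a. complex_of_real (\<mu> a)) * Q"
    using hermitian_diagonalizable[OF H] by metis
  define z where "z = (\<Sum>a<n. exp (- \<mu> a))"
  have z: "z > 0" unfolding z_def using n by (intro sum_pos) auto
  have mH: "- H = P * dg n (\<lambda>a. complex_of_real (- \<mu> a)) * Q"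
  proof -
    have "- H = (- 1) \<cdot>\<^sub>m H" by (intro eq_matI) auto
    then show ?thesis unfolding HP smult_sandwich_dg[OF P Q] by simp
  qed
  have E: "mexp (- H) = P * dg n (\<lambda>a. complex_of_real (exp (- \<mu> a))) * Q"
    unfolding mH mexp_diagonalized[OF P Q PQ] by (simp only: exp_of_real)
  have Z: "mtrace (mexp (- H)) = complex_of_real z"
    unfolding E mtrace_sandwich[OF P dg_carrier Q PQ(2)] by (simp add: mtrace_def z_def)
  define W where "W = Q * U"
  have W: "W \<in> carrier_mat n n" using Q U by (simp add: W_def)
  have PW: "P * W = U" unfolding W_def using P Q U PQ by (simp flip: assoc_mult_mat[of P n n Q n U n])
  have "P * dg n (\<lambda>a. complex_of_real (exp (- \<mu> a) / z)) * Q = U * dg n (\<lambda>a. complex_of_real (lam a)) * V"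
    using eq unfolding Z unfolding E smult_sandwich_dg[OF P Q] by simp
  then have "Q * (P * dg n (\<lambda>a. complex_of_real (exp (- \<mu> a) / z)) * Q) * U = Q * (U * dg n (\<lambda>a. complex_of_real (lam a)) * V) * U"
    by simp
  moreover have "Q * (P * D * Q) * U = D * W" if "D \<in> carrier_mat n n" for D
  proof -
    have "Q * (P * D * Q) * U = (Q * P) * (D * (Q * U))"
      using P Q U that by (simp add: assoc_mult_mat[of _ n n _ n _ n] del: PQ)
    then show ?thesis using PQ W that by (simp add: W_def[symmetric] left_mult_one_mat[of _ n n])
  qed
  moreover have "Q * (U * D * V) * U = W * D" if "D \<in> carrier_mat n n" for D
  proof -
    have "Q * (U * D * V) * U = (Q * U) * D * (V * U)"
      using U V Q that by (simp add: assoc_mult_mat[of _ n n _ n _ n] del: UV)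
    then show ?thesis using UV W that by (simp add: W_def[symmetric])
  qed
  ultimately have DW: "dg n (\<lambda>a. complex_of_real (exp (- \<mu> a) / z)) * W = W * dg n (\<lambda>a. complex_of_real (lam a))"
    by simp
  have Wab: "lam b = exp (- \<mu> a) / z" if "a < n" "b < n" "W $$ (a,b) \<noteq> 0" for a b
  proof -
    have "complex_of_real (exp (- \<mu> a) / z) * W $$ (a,b) = complex_of_real (lam b) * W $$ (a,b)"
      using arg_cong[OF DW, of "\<lambda>M. M $$ (a,b)"] that W
      unfolding mult_dg_index[OF W that(1,2)] by (simp add: mult.commute)
    then have "complex_of_real (exp (- \<mu> a) / z) = complex_of_real (lam b)"
      using that(3) by (simp only: mult_cancel_right) simp
    then show ?thesis by (simp only: of_real_eq_iff)
  qed
  have pos: "lam b > 0" if b: "b < n" for b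
  proof -
    \<comment> \<open>\<open>W\<close> has the left inverse \<open>V * P\<close>, so each of its
      columns has a nonzero entry; this identifies every \<open>lam b\<close> with some
      \<open>exp (- \<mu> a) / z\<close>, which is positive.\<close>
    have "(V * P * W) = 1\<^sub>m n"
      using PW UV P V W by (simp add: assoc_mult_mat[of _ n n _ n _ n])
    then have "(V * P * W) $$ (b,b) \<noteq> 0" using b by simp
    have idx: "(X * W) $$ (b,b) = (\<Sum>a<n. X $$ (b,a) * W $$ (a,b))" if "X \<in> carrier_mat n n" for X
      using that W b by (simp add: scalar_prod_def lessThan_atLeast0)
    note \<open>(V * P * W) $$ (b,b) \<noteq> 0\<close>
    moreover note idx[OF mult_carrier_mat[OF V P]]
    ultimately obtain a where "a < n" "W $$ (a,b) \<noteq> 0"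
      using sum.neutral[of "{..<n}" "\<lambda>a. (V * P) $$ (b,a) * W $$ (a,b)"] by auto
    from Wab[OF this(1) b this(2)] show ?thesis using z by simp
  qed
  have DW': "dg n (\<lambda>a. complex_of_real (- \<mu> a)) * W = W * dg n (\<lambda>a. complex_of_real (ln (z * lam a)))"
  proof (rule eq_matI)
    fix a b assume "a < dim_row (W * dg n (\<lambda>a. complex_of_real (ln (z * lam a))))"
      "b < dim_col (W * dg n (\<lambda>a. complex_of_real (ln (z * lam a))))"
    then have ab: "a < n" "b < n" using W by auto
    have "ln (z * lam b) = - \<mu> a" if "W $$ (a,b) \<noteq> 0"
      unfolding Wab[OF ab that] using z by simp
    then show "(dg n (\<lambda>a. complex_of_real (- \<mu> a)) * W) $$ (a,b) = (W * dg n (\<lambda>a. complex_of_real (ln (z * lam a)))) $$ (a,b)"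
      unfolding mult_dg_index[OF W ab] by (cases "W $$ (a,b) = 0") simp_all
  qed (use W in auto)
  have QWV: "Q = W * V"
    unfolding W_def using Q U V UV by (simp add: assoc_mult_mat[of Q n n U n V n])
  have "- H = P * (dg n (\<lambda>a. complex_of_real (- \<mu> a)) * (W * V))"
    unfolding mH QWV[symmetric] by (rule assoc_mult_mat[OF P dg_carrier Q])
  also have "dg n (\<lambda>a. complex_of_real (- \<mu> a)) * (W * V) = W * dg n (\<lambda>a. complex_of_real (ln (z * lam a))) * V"
    unfolding DW'[symmetric] by (rule assoc_mult_mat[OF dg_carrier W V, symmetric])
  also have "P * \<dots> = P * W * dg n (\<lambda>a. complex_of_real (ln (z * lam a))) * V"
    using P W V by (simp add: assoc_mult_mat[of _ n n _ n _ n])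
  finally show ?thesis using that[OF z Z pos] unfolding PW by blast
qed

section \<open>Scalar identities for the Kubo-Mori weight\<close>

text \<open>Rests on \<open>tanh ((ln a - ln b) / 2) = (a - b) / (a + b)\<close>. As a product equal
  to \<open>1\<close>, it gives both that the weight is nonzero and what its inverse is.\<close>

lemma c_KM_tent_hat:
  assumes "a > 0" "b > 0"
  shows "c_KM a b * ((a + b) / 2 * tent_hat (ln a - ln b)) = 1"
proof (cases "a = b")
  case True
  then show ?thesis using assms by (simp add: c_KM_def tent_hat_def)
next
  case False
  then have ln: "ln a - ln b \<noteq> 0" using assms by simp
  have "tanh ((ln a - ln b) / 2) = (a - b) / (a + b)"
  proof -
    \<comment> \<open>The square roots of \<open>a\<close> and \<open>b\<close>, in a form that
      combines with the exponentials in \<open>tanh\<close>.\<close>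
    define u v where "u = exp (ln a / 2)" and "v = exp (ln b / 2)"
    have uv: "u > 0" "v > 0" by (simp_all add: u_def v_def)
    have a: "a = u * u" and b: "b = v * v" using assms by (simp_all add: u_def v_def flip: exp_add)
    have e: "exp ((ln a - ln b) / 2) = u / v" "exp (- ((ln a - ln b) / 2)) = v / u"
      by (simp_all add: u_def v_def diff_divide_distrib flip: exp_diff)
    have "tanh ((ln a - ln b) / 2) = (u / v - v / u) / (u / v + v / u)"
      unfolding tanh_altdef e ..
    also have "\<dots> = (u * u - v * v) / (u * u + v * v)" using uv by (simp add: divide_simps)
    finally show ?thesis by (simp only: a b)
  qed
  then have "c_KM a b * ((a + b) / 2 * tent_hat (ln a - ln b))
      = (ln a - ln b) / (a - b) * ((a + b) / 2 * (((a - b) / (a + b)) / ((ln a - ln b) / 2)))"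
    using False ln by (simp only: c_KM_def tent_hat_def if_False)
  also have "\<dots> = 1"
  proof -
    have q: "x / y * (w / 2 * ((y / w) / (x / 2))) = 1" if "x \<noteq> 0" "y \<noteq> 0" "w \<noteq> 0" for x y w :: real
      using that by (simp add: field_simps)
    show ?thesis using ln False assms by (intro q) auto
  qed
  finally show ?thesis .
qed

text \<open>\<open>c_KM\<close> is the divided difference of \<open>ln\<close>, so that of
  \<open>exp\<close> at the logarithms is its reciprocal; the scale \<open>z\<close> cancels between
  the logarithms and survives only as a factor.\<close>

lemma exp_dd_ln:
  assumes "z > 0" "a > 0" "b > 0"
  shows "exp_dd (complex_of_real (ln (z * a))) (complex_of_real (ln (z * b))) = complex_of_real (z / c_KM a b)"
proof (cases "a = b")
  case True
  then show ?thesis using assms by (simp add: exp_dd_def c_KM_def exp_of_real)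
next
  case False
  then have "ln (z * a) \<noteq> ln (z * b)" using assms by simp
  then have "exp_dd (complex_of_real (ln (z * a))) (complex_of_real (ln (z * b)))
      = complex_of_real ((exp (ln (z * a)) - exp (ln (z * b))) / (ln (z * a) - ln (z * b)))"
    by (simp add: exp_dd_def flip: exp_of_real)
  also have "(exp (ln (z * a)) - exp (ln (z * b))) / (ln (z * a) - ln (z * b)) = (z * a - z * b) / (ln (z * a) - ln (z * b))"
    using assms by (simp only: exp_ln mult_pos_pos)
  also have "(z * a - z * b) / (ln (z * a) - ln (z * b)) = z * (a - b) / (ln a - ln b)"
    using assms by (simp add: ln_mult algebra_simps)
  finally show ?thesis using False by (simp add: c_KM_def)
qed

section \<open>The Gibbs state in its eigenbasis\<close>

text \<open>Collects the spectral data that \<open>gibbs_log\<close> provides, with \<open>V\<close>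
  as the inverse of \<open>U\<close>; the adjoint of \<open>U\<close> is substituted for it at the
  end.\<close>

locale gibbs =
  fixes n J :: nat and G :: "nat \<Rightarrow> complex mat" and \<theta> :: "nat \<Rightarrow> real"
    and U V :: "complex mat" and lam :: "nat \<Rightarrow> real" and z :: real
  assumes G: "m < J \<Longrightarrow> G m \<in> carrier_mat n n"
    and U: "U \<in> carrier_mat n n" and V: "V \<in> carrier_mat n n"
    and UV: "U * V = 1\<^sub>m n" and VU: "V * U = 1\<^sub>m n"
    and z: "z > 0" and lam: "a < n \<Longrightarrow> lam a > 0"
    and partition: "mtrace (mexp (- Gth n J G \<theta>)) = complex_of_real z"
    and minus_Gth: "- Gth n J G \<theta> = U * dg n (\<lambda>a. complex_of_real (ln (z * lam a))) * V"
begin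

definition b :: "nat \<Rightarrow> nat \<Rightarrow> nat \<Rightarrow> complex" where
  "b m k l = (V * G m * U) $$ (k,l)"

definition mean :: "nat \<Rightarrow> complex" where
  "mean m = (\<Sum>k<n. complex_of_real (lam k) * b m k k)"

lemma VGU: "m < J \<Longrightarrow> V * G m * U \<in> carrier_mat n n"
  by (intro mult_carrier_mat[of _ n n] G U V)

lemma G_eq: "m < J \<Longrightarrow> U * (V * G m * U) * V = G m"
  by (intro conj_sandwich[OF U _ V UV VU] G)

lemma mexp_minus_Gth: "mexp (- Gth n J G \<theta>) = U * dg n (\<lambda>a. complex_of_real (z * lam a)) * V"
proof -
  have "dg n (\<lambda>a. exp (complex_of_real (ln (z * lam a)))) = dg n (\<lambda>a. complex_of_real (z * lam a))"
    using z lam by (intro eq_matI) (auto simp: exp_of_real simp del: of_real_mult)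
  then show ?thesis unfolding minus_Gth mexp_diagonalized[OF U V UV VU] by simp
qed

lemma rho_eq: "rho n J G \<theta> = U * dg n (\<lambda>a. complex_of_real (lam a)) * V"
  unfolding rho_def partition unfolding mexp_minus_Gth smult_sandwich_dg[OF U V] using z by simp

lemma sum_lam: "(\<Sum>k<n. lam k) = 1"
proof -
  have "complex_of_real z = mtrace (U * dg n (\<lambda>a. complex_of_real (z * lam a)) * V)"
    using partition unfolding mexp_minus_Gth by simp
  also have "\<dots> = complex_of_real (z * (\<Sum>k<n. lam k))"
    unfolding mtrace_sandwich[OF U dg_carrier V VU] by (simp add: mtrace_def sum_distrib_left)
  finally show ?thesis using z by (simp del: of_real_mult)
qed

lemma mtrace_sandwich_dg:
  assumes "X \<in> carrier_mat n n"
  shows "mtrace ((U * X * V) * rho n J G \<theta>) = (\<Sum>k<n. complex_of_real (lam k) * X $$ (k,k))"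
  unfolding rho_eq sandwich_mult[OF U assms dg_carrier V VU]
    mtrace_sandwich[OF U mult_carrier_mat[OF assms dg_carrier] V VU]
  using assms by (simp add: mtrace_def mult_dg_index mult.commute del: index_mult_mat(1))

lemma mtrace_G_rho: "m < J \<Longrightarrow> mtrace (G m * rho n J G \<theta>) = mean m"
  using mtrace_sandwich_dg[OF VGU] by (simp add: G_eq mean_def b_def)

text \<open>Quotient rule for the exponential over its trace: the first term comes from
  differentiating the exponential, the diagonal one from the partition function, whose derivative is
  \<open>- z * mean m\<close>.\<close>

lemma mat_partial_rho:
  assumes m: "m < J"
  shows "V * mat_partial n (rho n J G) m \<theta> * U =
    mat n n (\<lambda>(k,l). - b m k l / complex_of_real (c_KM (lam k) (lam l))
      + (if k = l then complex_of_real (lam k) * mean m else 0))" (is "_ = ?N")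
proof -
  define X where "X = - Gth n J G \<theta>"
  define Y where "Y = - G m"
  have X: "X \<in> carrier_mat n n" by (simp add: X_def Gth_def)
  have Y: "Y \<in> carrier_mat n n" using G[OF m] by (simp add: Y_def)
  \<comment> \<open>Varying one coordinate moves the exponent along an affine line, so the
    derivative of \<open>mexp (X + w Y)\<close> at \<open>w = 0\<close> suffices.\<close>
  have upd: "- Gth n J G (\<theta>(m := s)) = X + complex_of_real (s - \<theta> m) \<cdot>\<^sub>m Y" for s
  proof (rule eq_matI)
    fix a b assume ab: "a < dim_row (X + complex_of_real (s - \<theta> m) \<cdot>\<^sub>m Y)" "b < dim_col (X + complex_of_real (s - \<theta> m) \<cdot>\<^sub>m Y)"
    have "(\<Sum>j<J. complex_of_real ((\<theta>(m := s)) j) * G j $$ (a,b))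
       = (\<Sum>j<J. complex_of_real (\<theta> j) * G j $$ (a,b) + (if j = m then complex_of_real (s - \<theta> m) * G m $$ (a,b) else 0))"
      by (intro sum.cong) (auto simp: algebra_simps)
    also have "\<dots> = (\<Sum>j<J. complex_of_real (\<theta> j) * G j $$ (a,b)) + complex_of_real (s - \<theta> m) * G m $$ (a,b)"
      using m by (simp add: sum.distrib)
    finally show "(- Gth n J G (\<theta>(m := s))) $$ (a,b) = (X + complex_of_real (s - \<theta> m) \<cdot>\<^sub>m Y) $$ (a,b)"
      using ab G[OF m] by (simp add: X_def Y_def Gth_def)
  qed (use G[OF m] in \<open>simp_all add: Y_def Gth_def\<close>)
  define M where "M = mat n n (\<lambda>(k,l). exp_dd (complex_of_real (ln (z * lam k))) (complex_of_real (ln (z * lam l))) * (V * Y * U) $$ (k,l))"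
  have M: "M \<in> carrier_mat n n" by (simp add: M_def)
  have Mkl: "M $$ (k,l) = - complex_of_real z * (b m k l / complex_of_real (c_KM (lam k) (lam l)))" if "k < n" "l < n" for k l
  proof -
    have "(V * Y * U) $$ (k,l) = - b m k l"
      unfolding b_def sandwich_index[OF V Y U that] sandwich_index[OF V G[OF m] U that]
      using G[OF m] by (simp add: Y_def sum_negf)
    then show ?thesis using that by (simp add: M_def exp_dd_ln z lam)
  qed
  define E where "E w = mexp (X + w \<cdot>\<^sub>m Y)" for w
  have E_dim: "dim_row (E w) = n" for w using X Y by (simp add: E_def mexp_def)
  have dE: "((\<lambda>w. E w $$ (a,b)) has_field_derivative (U * M * V) $$ (a,b)) (at 0)" if "a < n" "b < n" for a b
    unfolding E_def M_def X_def minus_Gth by (rule has_field_derivative_mexp_diagonalized[OF U V UV VU Y that])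
  have E0: "E 0 = U * dg n (\<lambda>a. complex_of_real (z * lam a)) * V"
  proof -
    have "X + 0 \<cdot>\<^sub>m Y = X" using X Y by (intro eq_matI) auto
    then show ?thesis using mexp_minus_Gth by (simp add: E_def X_def)
  qed
  have Z0: "mtrace (E 0) = complex_of_real z"
    using partition unfolding E0 mexp_minus_Gth .
  have "((\<lambda>w. \<Sum>a<n. E w $$ (a,a)) has_field_derivative (\<Sum>a<n. (U * M * V) $$ (a,a))) (at 0)"
    by (intro DERIV_sum dE) auto
  \<comment> \<open>The trace sees only diagonal entries, where \<open>c_KM\<close> is
    \<open>1 / lam k\<close>.\<close>
  moreover have "(\<Sum>a<n. (U * M * V) $$ (a,a)) = - complex_of_real z * mean m"
  proof -
    have "(\<Sum>a<n. (U * M * V) $$ (a,a)) = mtrace (U * M * V)" using U by (simp add: mtrace_def)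
    also have "\<dots> = mtrace M" by (rule mtrace_sandwich[OF U M V VU])
    also have "\<dots> = - complex_of_real z * mean m"
      using M lam by (auto simp: mtrace_def Mkl mean_def c_KM_def sum_distrib_left sum_negf[symmetric] intro!: sum.cong)
    finally show ?thesis .
  qed
  ultimately have dZ: "((\<lambda>w. mtrace (E w)) has_field_derivative - complex_of_real z * mean m) (at 0)"
    by (simp add: mtrace_def E_dim)
  have quot: "(d * w - e * (- w * g)) / (w * w) = (d + g * e) / w" if "w \<noteq> 0" for d e g w :: complex
    using that by (simp add: field_simps)
  have N: "?N \<in> carrier_mat n n" by simp
  have "mat_partial n (rho n J G) m \<theta> = U * ?N * V"
  proof (rule eq_matI)
    fix a c assume "a < dim_row (U * ?N * V)" "c < dim_col (U * ?N * V)"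
    then have ac: "a < n" "c < n" using U V by auto
    let ?D = "((U * M * V) $$ (a,c) * mtrace (E 0) - E 0 $$ (a,c) * (- complex_of_real z * mean m)) / (mtrace (E 0) * mtrace (E 0))"
    have "((\<lambda>w. E w $$ (a,c) / mtrace (E w)) has_field_derivative ?D) (at 0)"
      by (intro DERIV_divide dE dZ ac) (use Z0 z in simp)
    \<comment> \<open>The point \<open>0\<close> is written as a difference so that the chain rule
      for the shift by \<open>\<theta> m\<close> matches; afterwards the complex derivative is
      restricted to the real line.\<close>
    then have "((\<lambda>w. E w $$ (a,c) / mtrace (E w)) has_field_derivative ?D) (at (complex_of_real (\<theta> m) - complex_of_real (\<theta> m)))"
      by simp
    then have "((\<lambda>w. E (w - complex_of_real (\<theta> m)) $$ (a,c) / mtrace (E (w - complex_of_real (\<theta> m)))) has_field_derivative ?D * 1)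
        (at (complex_of_real (\<theta> m)))"
      by (rule DERIV_chain2) (auto intro!: derivative_eq_intros)
    then have "((\<lambda>s. E (complex_of_real s - complex_of_real (\<theta> m)) $$ (a,c) / mtrace (E (complex_of_real s - complex_of_real (\<theta> m))))
        has_vector_derivative ?D * 1) (at (\<theta> m))"
      by (rule has_vector_derivative_real_field)
    moreover have "rho n J G (\<theta>(m := s)) $$ (a,c) = E (complex_of_real s - complex_of_real (\<theta> m)) $$ (a,c) / mtrace (E (complex_of_real s - complex_of_real (\<theta> m)))" for s
      unfolding rho_def upd E_def using X Y ac by (simp add: mexp_def)
    ultimately have "((\<lambda>s. rho n J G (\<theta>(m := s)) $$ (a,c)) has_vector_derivative ?D) (at (\<theta> m))"
      by simp
    then have "mat_partial n (rho n J G) m \<theta> $$ (a,c) = ?D"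
      using ac by (simp add: mat_partial_def vector_derivative_at)
    also have "\<dots> = ((U * M * V) $$ (a,c) + mean m * E 0 $$ (a,c)) / complex_of_real z"
      unfolding Z0 by (rule quot) (use z in simp)
    also have "\<dots> = (U * ?N * V) $$ (a,c)"
    proof -
      have "(U * M * V) $$ (a,c) + mean m * E 0 $$ (a,c) = complex_of_real z * (U * ?N * V) $$ (a,c)"
        unfolding E0
        by (rule sandwich_linear[OF U M dg_carrier N V _ ac]) (simp add: Mkl algebra_simps)
      then show ?thesis using z by (simp only:) simp
    qed
    finally show "mat_partial n (rho n J G) m \<theta> $$ (a,c) = (U * ?N * V) $$ (a,c)" .
  qed (use U V in \<open>auto simp: mat_partial_def\<close>)
  then show ?thesis using conj_sandwich[OF V N U VU UV] by simp
qed

text \<open>Conjugation by the unitary evolution multiplies entry \<open>(k,l)\<close> by a phase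
  whose frequency is the difference of the logarithms of the eigenvalues, from which
  \<open>z\<close> drops out; averaging the phase over the tent density gives
  \<open>tent_hat\<close>.\<close>

lemma Phi_eq:
  assumes X: "X \<in> carrier_mat n n"
  shows "Phi n J G \<theta> X = U * mat n n (\<lambda>(k,l). complex_of_real (tent_hat (ln (lam l) - ln (lam k))) * (V * X * U) $$ (k,l)) * V"
    (is "_ = U * ?F * V")
proof (rule eq_matI)
  define x where "x k = ln (z * lam k)" for k
  define B where "B = V * X * U"
  have B: "B \<in> carrier_mat n n" using V X U by (simp add: B_def)
  have xd: "x l - x k = ln (lam l) - ln (lam k)" if "k < n" "l < n" for k l
    using that z lam[of k] lam[of l] by (simp add: x_def ln_mult)
  have smult: "c \<cdot>\<^sub>m Gth n J G \<theta> = U * dg n (\<lambda>a. - c * complex_of_real (x a)) * V" for c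
  proof -
    have "c \<cdot>\<^sub>m Gth n J G \<theta> = (- c) \<cdot>\<^sub>m (- Gth n J G \<theta>)" by (intro eq_matI) auto
    then show ?thesis unfolding minus_Gth smult_sandwich_dg[OF U V] x_def .
  qed
  have conj: "mexp ((- \<i> * complex_of_real t) \<cdot>\<^sub>m Gth n J G \<theta>) * X * mexp ((\<i> * complex_of_real t) \<cdot>\<^sub>m Gth n J G \<theta>)
     = U * mat n n (\<lambda>(k,l). exp (- \<i> * of_real ((x l - x k) * t)) * B $$ (k,l)) * V" for t
  proof -
    let ?D = "\<lambda>c. dg n (\<lambda>a. exp (c * complex_of_real (x a)))"
    have "mexp ((- \<i> * complex_of_real t) \<cdot>\<^sub>m Gth n J G \<theta>) * X * mexp ((\<i> * complex_of_real t) \<cdot>\<^sub>m Gth n J G \<theta>)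
      = (U * ?D (\<i> * complex_of_real t) * V) * (U * B * V) * (U * ?D (- \<i> * complex_of_real t) * V)"
      unfolding smult mexp_diagonalized[OF U V UV VU] B_def conj_sandwich[OF U X V UV VU] by simp
    also have "\<dots> = U * (?D (\<i> * complex_of_real t) * B * ?D (- \<i> * complex_of_real t)) * V"
      unfolding sandwich_mult[OF U dg_carrier B V VU]
        sandwich_mult[OF U mult_carrier_mat[OF dg_carrier B] dg_carrier V VU] ..
    also have "?D (\<i> * complex_of_real t) * B * ?D (- \<i> * complex_of_real t)
        = mat n n (\<lambda>(k,l). exp (- \<i> * of_real ((x l - x k) * t)) * B $$ (k,l))" (is "?L = ?R")
    proof (rule eq_matI)
      fix k l assume "k < dim_row ?R" "l < dim_col ?R"
      then have kl: "k < n" "l < n" by auto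
      show "?L $$ (k,l) = ?R $$ (k,l)"
        unfolding mult_dg_index(1)[OF mult_carrier_mat[OF dg_carrier B] kl] mult_dg_index(2)[OF B kl]
        using kl by (simp add: algebra_simps flip: exp_add)
    qed (use B in auto)
    finally show ?thesis .
  qed
  fix a c assume "a < dim_row (U * ?F * V)" "c < dim_col (U * ?F * V)"
  then have ac: "a < n" "c < n" using U V by auto
  have int: "has_bochner_integral lborel (\<lambda>t. \<Sum>k<n. \<Sum>l<n. U $$ (a,k) * B $$ (k,l) * V $$ (l,c) *
        (complex_of_real (tent t) * exp (- \<i> * of_real ((x l - x k) * t))))
      (\<Sum>k<n. \<Sum>l<n. U $$ (a,k) * B $$ (k,l) * V $$ (l,c) * complex_of_real (tent_hat (x l - x k)))"
    by (intro has_bochner_integral_sum has_bochner_integral_mult_right tent_fourier)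
  have F: "?F \<in> carrier_mat n n" by simp
  have "Phi n J G \<theta> X $$ (a,c) = integral\<^sup>L lborel (\<lambda>t. \<Sum>k<n. \<Sum>l<n. U $$ (a,k) * B $$ (k,l) * V $$ (l,c) *
        (complex_of_real (tent t) * exp (- \<i> * of_real ((x l - x k) * t))))"
  proof -
    have "complex_of_real (tent t) * (U * mat n n (\<lambda>(k,l). exp (- \<i> * of_real ((x l - x k) * t)) * B $$ (k,l)) * V) $$ (a,c)
       = (\<Sum>k<n. \<Sum>l<n. U $$ (a,k) * B $$ (k,l) * V $$ (l,c) *
        (complex_of_real (tent t) * exp (- \<i> * of_real ((x l - x k) * t))))" for t
      unfolding sandwich_index[OF U mat_carrier V ac] sum_distrib_left
      by (intro sum.cong refl) (simp add: mult_ac)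
    then show ?thesis using ac unfolding Phi_def conj by simp
  qed
  also have "\<dots> = (\<Sum>k<n. \<Sum>l<n. U $$ (a,k) * B $$ (k,l) * V $$ (l,c) * complex_of_real (tent_hat (x l - x k)))"
    using int by (rule has_bochner_integral_integral_eq)
  also have "\<dots> = (U * ?F * V) $$ (a,c)"
    unfolding sandwich_index[OF U F V ac]
    by (intro sum.cong refl) (simp add: xd B_def[symmetric] mult_ac)
  finally show "Phi n J G \<theta> X $$ (a,c) = (U * ?F * V) $$ (a,c)" .
qed (use U V in \<open>auto simp: Phi_def\<close>)

text \<open>The anticommutator symmetrises the weight \<open>lam k\<close> to
  \<open>(lam k + lam l) / 2\<close>, and this mean times \<open>tent_hat\<close> is the reciprocal
  of \<open>c_KM\<close>.\<close>

lemma mtrace_anticomm_Phi: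
  assumes i: "i < J" and j: "j < J"
  shows "mtrace (anticomm (G i) (Phi n J G \<theta> (G j)) * rho n J G \<theta>) / 2 =
    (\<Sum>k<n. \<Sum>l<n. b i k l * b j l k / complex_of_real (c_KM (lam k) (lam l)))"
proof -
  define B where "B = V * G i * U"
  define F where "F = mat n n (\<lambda>(k,l). complex_of_real (tent_hat (ln (lam l) - ln (lam k))) * (V * G j * U) $$ (k,l))"
  have B: "B \<in> carrier_mat n n" unfolding B_def by (rule VGU[OF i])
  have F: "F \<in> carrier_mat n n" by (simp add: F_def)
  have "anticomm (G i) (Phi n J G \<theta> (G j)) = (U * B * V) * (U * F * V) + (U * F * V) * (U * B * V)"
    unfolding anticomm_def Phi_eq[OF G[OF j]] B_def G_eq[OF i] F_def ..
  also have "\<dots> = U * (B * F + F * B) * V"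
    unfolding sandwich_mult[OF U B F V VU] sandwich_mult[OF U F B V VU]
    by (intro sandwich_add[OF U _ _ V] mult_carrier_mat[OF B F] mult_carrier_mat[OF F B])
  finally have A: "anticomm (G i) (Phi n J G \<theta> (G j)) = U * (B * F + F * B) * V" .
  have "mtrace (anticomm (G i) (Phi n J G \<theta> (G j)) * rho n J G \<theta>)
      = (\<Sum>k<n. complex_of_real (lam k) * (B * F + F * B) $$ (k,k))"
    unfolding A by (rule mtrace_sandwich_dg) (use B F in simp)
  also have "\<dots> = (\<Sum>k<n. \<Sum>l<n. complex_of_real (lam k) * (B $$ (k,l) * F $$ (l,k)))
     + (\<Sum>k<n. \<Sum>l<n. complex_of_real (lam k) * (B $$ (l,k) * F $$ (k,l)))"
    using B F by (simp add: scalar_prod_def lessThan_atLeast0 ring_distribs sum.distrib sum_distrib_left mult_ac)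
  \<comment> \<open>Exchanging the names of the indices brings both orders of the product to the
    common factor \<open>B $$ (k,l) * F $$ (l,k)\<close>.\<close>
  also have "(\<Sum>k<n. \<Sum>l<n. complex_of_real (lam k) * (B $$ (l,k) * F $$ (k,l)))
     = (\<Sum>k<n. \<Sum>l<n. complex_of_real (lam l) * (B $$ (k,l) * F $$ (l,k)))"
    by (rule sum.swap)
  finally have "mtrace (anticomm (G i) (Phi n J G \<theta> (G j)) * rho n J G \<theta>) / 2
     = (\<Sum>k<n. \<Sum>l<n. (complex_of_real (lam k) * (B $$ (k,l) * F $$ (l,k))
          + complex_of_real (lam l) * (B $$ (k,l) * F $$ (l,k))) / 2)"
    by (simp only: sum.distrib[symmetric] sum_divide_distrib)
  also have "\<dots> = (\<Sum>k<n. \<Sum>l<n. complex_of_real ((lam k + lam l) / 2) * (B $$ (k,l) * F $$ (l,k)))"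
    by (intro sum.cong refl) (simp add: algebra_simps add_divide_distrib)
  also have "\<dots> = (\<Sum>k<n. \<Sum>l<n. b i k l * b j l k / complex_of_real (c_KM (lam k) (lam l)))"
  proof (intro sum.cong refl)
    fix k l assume kl: "k \<in> {..<n}" "l \<in> {..<n}"
    have c: "c_KM (lam k) (lam l) * ((lam k + lam l) / 2 * tent_hat (ln (lam k) - ln (lam l))) = 1"
      using kl by (intro c_KM_tent_hat lam) auto
    then have "c_KM (lam k) (lam l) \<noteq> 0" by auto
    with c have "(lam k + lam l) / 2 * tent_hat (ln (lam k) - ln (lam l)) = 1 / c_KM (lam k) (lam l)"
      by (simp add: field_simps)
    then have "complex_of_real ((lam k + lam l) / 2) * complex_of_real (tent_hat (ln (lam k) - ln (lam l)))
       = 1 / complex_of_real (c_KM (lam k) (lam l))"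
      by (metis of_real_1 of_real_divide of_real_mult)
    moreover have "complex_of_real ((lam k + lam l) / 2) * (B $$ (k,l) * F $$ (l,k))
      = (complex_of_real ((lam k + lam l) / 2) * complex_of_real (tent_hat (ln (lam k) - ln (lam l)))) * (b i k l * b j l k)"
      using kl by (simp add: F_def B_def b_def mult_ac del: index_mult_mat(1))
    ultimately show "complex_of_real ((lam k + lam l) / 2) * (B $$ (k,l) * F $$ (l,k))
      = b i k l * b j l k / complex_of_real (c_KM (lam k) (lam l))" by simp
  qed
  finally show ?thesis .
qed

text \<open>Expand the product of the two derivatives. The diagonal corrections carry the weight
  \<open>lam k\<close>; as the eigenvalues sum to \<open>1\<close>, they add up to
  \<open>1 - 1 - 1 = -1\<close> times the product of the means.\<close>

lemma KM_info_rho: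
  assumes adj: "adj U = V" and i: "i < J" and j: "j < J"
  shows "KM_info n (rho n J G) \<theta> U lam i j =
    mtrace (anticomm (G i) (Phi n J G \<theta> (G j)) * rho n J G \<theta>) / 2
      - mtrace (G i * rho n J G \<theta>) * mtrace (G j * rho n J G \<theta>)"
proof -
  let ?c = "\<lambda>k l. complex_of_real (c_KM (lam k) (lam l))"
  let ?N = "\<lambda>m k l. - b m k l / ?c k l + (if k = l then complex_of_real (lam k) * mean m else 0)"
  have c_nz: "?c k l \<noteq> 0" if "k < n" "l < n" for k l
    using c_KM_tent_hat[OF lam[OF that(1)] lam[OF that(2)]] by auto
  \<comment> \<open>The second derivative enters with indices \<open>(l,k)\<close>, so its
    denominator has to be matched with that of the first.\<close>
  have c_sym: "c_KM a d = c_KM d a" for a d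
    by (simp add: c_KM_def) (metis minus_diff_eq minus_divide_divide)
  have "KM_info n (rho n J G) \<theta> U lam i j = (\<Sum>k<n. \<Sum>l<n. ?c k l * ?N i k l * ?N j l k)"
    unfolding KM_info_def adj mat_partial_rho[OF i] mat_partial_rho[OF j] by (intro sum.cong refl) auto
  also have "\<dots> = (\<Sum>k<n. \<Sum>l<n. b i k l * b j l k / ?c k l
      + (if l = k then complex_of_real (lam k) * mean i * mean j
          - complex_of_real (lam k) * b i k k * mean j - complex_of_real (lam k) * b j k k * mean i else 0))"
  proof (intro sum.cong refl)
    fix k l assume kl: "k \<in> {..<n}" "l \<in> {..<n}"
    show "?c k l * ?N i k l * ?N j l k = b i k l * b j l k / ?c k l
      + (if l = k then complex_of_real (lam k) * mean i * mean j
          - complex_of_real (lam k) * b i k k * mean j - complex_of_real (lam k) * b j k k * mean i else 0)"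
    proof (cases "k = l")
      case True
      have "lam k \<noteq> 0" using lam[of k] kl by auto
      then show ?thesis using True by (simp add: c_KM_def field_simps)
    next
      case False
      then show ?thesis using c_nz[of k l] kl by (simp add: c_sym[of "lam l" "lam k"])
    qed
  qed
  also have "\<dots> = (\<Sum>k<n. \<Sum>l<n. b i k l * b j l k / ?c k l)
      + (\<Sum>k<n. complex_of_real (lam k) * mean i * mean j
          - complex_of_real (lam k) * b i k k * mean j - complex_of_real (lam k) * b j k k * mean i)"
    by (simp add: sum.distrib)
  also have "(\<Sum>k<n. complex_of_real (lam k) * mean i * mean j
          - complex_of_real (lam k) * b i k k * mean j - complex_of_real (lam k) * b j k k * mean i)
      = complex_of_real (\<Sum>k<n. lam k) * mean i * mean j - mean i * mean j - mean j * mean i"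
    by (simp add: sum_subtractf sum_distrib_right mean_def)
  finally show ?thesis
    unfolding mtrace_anticomm_Phi[OF i j] mtrace_G_rho[OF i] mtrace_G_rho[OF j] sum_lam by simp
qed

end

lemma hermitian_Gth:
  assumes "\<And>m. m < J \<Longrightarrow> hermitian n (G m)"
  shows "hermitian n (Gth n J G \<theta>)"
proof -
  have "cnj (G m $$ (b,a)) = G m $$ (a,b)" if "m < J" "a < n" "b < n" for m a b
    using assms[OF that(1)] that(2,3) unfolding hermitian_def adj_def
    by (metis carrier_matD index_mat(1) case_prod_conv)
  then show ?thesis
    unfolding hermitian_def adj_def Gth_def by (auto intro!: eq_matI sum.cong)
qed

theorem theorem2:
  fixes n J :: nat and G :: "nat \<Rightarrow> complex mat" and \<theta> :: "nat \<Rightarrow> real"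
    and U :: "complex mat" and lam :: "nat \<Rightarrow> real" and i j :: nat
  assumes "n > 0"
    and "\<And>m. m < J \<Longrightarrow> hermitian n (G m)"
    and "i < J" and "j < J"
    and "unitary n U"
    and "rho n J G \<theta> = U * mat n n (\<lambda>(a,b). if a = b then complex_of_real (lam a) else 0) * adj U"
  shows "KM_info n (rho n J G) \<theta> U lam i j =
           mtrace (anticomm (G i) (Phi n J G \<theta> (G j)) * rho n J G \<theta>) / 2
           - mtrace (G i * rho n J G \<theta>) * mtrace (G j * rho n J G \<theta>)"
proof -
  have U: "U \<in> carrier_mat n n" and UV: "U * adj U = 1\<^sub>m n" "adj U * U = 1\<^sub>m n"
    using assms(5) by (auto simp: unitary_def)
  have V: "adj U \<in> carrier_mat n n" using U by (simp add: adj_def)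
  have "(1 / mtrace (mexp (- Gth n J G \<theta>))) \<cdot>\<^sub>m mexp (- Gth n J G \<theta>)
      = U * dg n (\<lambda>a. complex_of_real (lam a)) * adj U"
    using assms(6) by (simp only: rho_def dg_def)
  \<comment> \<open>The given decomposition of the state, in whatever eigenbasis \<open>U\<close>
    was chosen, is turned into one of the Hamiltonian in the same basis.\<close>
  from gibbs_log[OF hermitian_Gth[OF assms(2)] assms(1) U V UV this]
  obtain z where "z > 0" "mtrace (mexp (- Gth n J G \<theta>)) = complex_of_real z"
    "\<And>a. a < n \<Longrightarrow> lam a > 0"
    "- Gth n J G \<theta> = U * dg n (\<lambda>a. complex_of_real (ln (z * lam a))) * adj U"
    by blast
  then interpret gibbs n J G \<theta> U "adj U" lam z
    using assms(2) U V UV by unfold_locales (auto simp: hermitian_def)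
  show ?thesis by (rule KM_info_rho[OF refl assms(3,4)])
qed

end
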